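(* Let $Q(X,Y)=AX^2+BXY+CY^2$ be a binary quadratic form with integer coefficients which is primitive ($A,B,C$ have no common divisor other than $\pm1$), indefinite, and which is not, up to a rational multiple, a product of two integral linear forms. Let $\operatorname{D}_Q=B^2-4AC$ be its discriminant (so $\operatorname{D}_Q>0$ is not a square). Let $\mathcal{P}$ be the set of elements of $\mathbb{Z}^2$ with coprime coordinates, let $\operatorname{SO}(Q,\mathbb{Z})$ be the integral special orthogonal group of $Q$, and let $$\Psi_Q(t)=\operatorname{Card}\big(\operatorname{SO}(Q,\mathbb{Z})\backslash\{x\in\mathcal{P}\;:\;|Q(x)|\leq t\}\big).$$ Let $(t_Q,u_Q)$ be the fundamental solution of the Pell–Fermat equation $t^2-\operatorname{D}_Q u^2=4$, let $\epsilon_Q=\frac{t_Q+u_Q\sqrt{\operatorname{D}_Q}}{2}$ and $R_Q=\log\epsilon_Q$. Then, as $t\to+\infty$, $$\Psi_Q(t)\sim\frac{12\,R_Q}{\pi^2\sqrt{\operatorname{D}_Q}}\;t .$$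
   Context: $\operatorname{SO}(Q,\mathbb{Z})$ (the group of automorphs of $Q$) is the subgroup of $\gamma\in\operatorname{SL}_2(\mathbb{Z})$ such that $Q\circ\gamma=Q$; it acts linearly on $\mathbb{Z}^2$, preserving $\mathcal{P}$. The fundamental solution $(t_Q,u_Q)$ is the integer solution with $t_Q,u_Q>0$ and $u_Q$ minimal. *)

theory Defs
  imports "HOL-Analysis.Analysis" "HOL-Library.Landau_Symbols"
begin

text \<open>The form is polymorphic in the ring of its arguments, so that the same coefficients
  can be evaluated on integral, rational and real vectors.\<close>

definition bqf :: "int \<Rightarrow> int \<Rightarrow> int \<Rightarrow> ('a::comm_ring_1) ^ 2 \<Rightarrow> 'a" where
  "bqf A B C x = of_int A * (x $ 1)\<^sup>2 + of_int B * (x $ 1) * (x $ 2) + of_int C * (x $ 2)\<^sup>2"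

definition bqf_disc :: "int \<Rightarrow> int \<Rightarrow> int \<Rightarrow> int" where
  "bqf_disc A B C = B\<^sup>2 - 4 * A * C"

definition bqf_primitive :: "int \<Rightarrow> int \<Rightarrow> int \<Rightarrow> bool" where
  "bqf_primitive A B C \<longleftrightarrow>
     (\<forall>d. d dvd A \<and> d dvd B \<and> d dvd C \<longrightarrow> d = 1 \<or> d = -1)"

definition bqf_indefinite :: "int \<Rightarrow> int \<Rightarrow> int \<Rightarrow> bool" where
  "bqf_indefinite A B C \<longleftrightarrow>
     (\<exists>x :: real ^ 2. bqf A B C x > 0) \<and> (\<exists>x :: real ^ 2. bqf A B C x < 0)"

definition bqf_product_of_linear_forms :: "int \<Rightarrow> int \<Rightarrow> int \<Rightarrow> bool" where
  "bqf_product_of_linear_forms A B C \<longleftrightarrow>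
     (\<exists>(q :: rat) (a :: int) (b :: int) (c :: int) (d :: int). q \<noteq> 0 \<and>
        (\<forall>x :: rat ^ 2. bqf A B C x =
           q * ((of_int a * x $ 1 + of_int b * x $ 2) * (of_int c * x $ 1 + of_int d * x $ 2))))"

definition SL2Z :: "(int ^ 2 ^ 2) set" where
  "SL2Z = {\<gamma>. det \<gamma> = 1}"

definition SO_bqf :: "int \<Rightarrow> int \<Rightarrow> int \<Rightarrow> (int ^ 2 ^ 2) set" where
  "SO_bqf A B C = {\<gamma> \<in> SL2Z. \<forall>x :: int ^ 2. bqf A B C (\<gamma> *v x) = bqf A B C x}"

definition primitive_vectors :: "(int ^ 2) set" where
  "primitive_vectors = {x. coprime (x $ 1) (x $ 2)}"

definition SO_orbit :: "int \<Rightarrow> int \<Rightarrow> int \<Rightarrow> int ^ 2 \<Rightarrow> (int ^ 2) set" where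
  "SO_orbit A B C x = (\<lambda>\<gamma>. \<gamma> *v x) ` SO_bqf A B C"

definition Psi_bqf :: "int \<Rightarrow> int \<Rightarrow> int \<Rightarrow> real \<Rightarrow> nat" where
  "Psi_bqf A B C t =
     card (SO_orbit A B C ` {x \<in> primitive_vectors. real_of_int \<bar>bqf A B C x\<bar> \<le> t})"

definition is_fundamental_solution :: "int \<Rightarrow> int \<times> int \<Rightarrow> bool" where
  "is_fundamental_solution D = (\<lambda>(t, u).
     t > 0 \<and> u > 0 \<and> t\<^sup>2 - D * u\<^sup>2 = 4 \<and>
     (\<forall>t' u'. t' > 0 \<and> u' > 0 \<and> t'\<^sup>2 - D * u'\<^sup>2 = 4 \<longrightarrow> u \<le> u'))"

text \<open>The description is proper because there is exactly one fundamental solution whenever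
  \<open>D > 0\<close> is not a square.\<close>

definition fundamental_solution :: "int \<Rightarrow> int \<times> int" where
  "fundamental_solution D = (THE p. is_fundamental_solution D p)"

definition fundamental_unit :: "int \<Rightarrow> real" where
  "fundamental_unit D =
     (case fundamental_solution D of (t, u) \<Rightarrow> (of_int t + of_int u * sqrt (of_int D)) / 2)"

definition bqf_regulator :: "int \<Rightarrow> int \<Rightarrow> int \<Rightarrow> real" where
  "bqf_regulator A B C = ln (fundamental_unit (bqf_disc A B C))"

end

theory Submission
  imports Defs
begin

text \<open>Over \<open>\<real>\<close> the form splits, \<open>4 A Q = \<xi> \<eta>\<close> with conjugate linear forms \<open>\<xi>\<close> and \<open>\<eta>\<close> that have no nonzero
integral zero. An integral automorph multiplies \<open>\<xi>\<close> by a unit \<open>(t + u \<surd>D) / 2\<close> with \<open>t\<^sup>2 - D u\<^sup>2 = 4\<close> and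
\<open>\<eta>\<close> by its inverse, and every such unit occurs (\<open>SO_entries\<close>, \<open>xi_action\<close>, \<open>SO_of_Pell\<close>). As the
least unit above \<open>1\<close> is the fundamental one, each orbit of nonzero vectors has exactly one representative with
\<open>s \<le> \<xi> < \<epsilon> s\<close>, for any \<open>s > 0\<close>.

Take \<open>s = \<surd>t\<close>. Then the orbits counted by \<open>\<Psi>(t)\<close> are the primitive lattice points in the dilate by \<open>\<surd>t\<close> of the
bounded region \<open>1 \<le> \<xi> < \<epsilon>\<close>, \<open>\<bar>\<xi> \<eta>\<bar> \<le> 4 \<bar>A\<bar>\<close> (\<open>Psi_eq_prim_points\<close>). This region has area
\<open>2 ln \<epsilon> / \<surd>D\<close> (\<open>emeasure_hyp_sector\<close>) and a null frontier. The number of all lattice points in the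
dilate is therefore asymptotic to \<open>t\<close> times the area (\<open>lattice_count_area\<close>), and the proportion \<open>6/\<pi>\<^sup>2\<close> of
them is primitive (\<open>primitive_lattice_count_area\<close>), which gives the constant \<open>12 ln \<epsilon> / (\<pi>\<^sup>2 \<surd>D)\<close>.

The passage from all points to primitive ones uses that \<open>\<zeta>(2) - 1 < 1\<close> in place of Moebius inversion
(\<open>bounded_zeta2_transform_inversion\<close>). That a fundamental unit exists at all is Dirichlet's
approximation theorem together with the pigeonhole principle (\<open>Pell_solution_exists\<close>).\<close>

section \<open>Lattice points in dilates of a plane region\<close>

lemma lattice_points_scaled_finite:
  fixes S :: "(real \<times> real) set"
  assumes "bounded S" "s > 0"
  shows "finite {(m, n). (real_of_int m / s, real_of_int n / s) \<in> S}" (is "finite ?F")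
proof -
  obtain r where r: "\<And>z. z \<in> S \<Longrightarrow> norm z \<le> r"
    using assms(1) by (auto simp: bounded_iff)
  have "?F \<subseteq> {- \<lceil>r * s\<rceil>..\<lceil>r * s\<rceil>} \<times> {- \<lceil>r * s\<rceil>..\<lceil>r * s\<rceil>}"
  proof clarify
    fix m n assume "(real_of_int m / s, real_of_int n / s) \<in> S"
    from r[OF this] have "norm (real_of_int m / s) \<le> r" "norm (real_of_int n / s) \<le> r"
      using norm_fst_le[of "real_of_int m / s" "real_of_int n / s"]
        norm_snd_le[of "real_of_int n / s" "real_of_int m / s"] by linarith+
    then have "\<bar>real_of_int m\<bar> \<le> r * s" "\<bar>real_of_int n\<bar> \<le> r * s"
      using assms(2) by (auto simp: field_simps)
    then show "m \<in> {- \<lceil>r * s\<rceil>..\<lceil>r * s\<rceil>} \<and> n \<in> {- \<lceil>r * s\<rceil>..\<lceil>r * s\<rceil>}"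
      by (auto simp: abs_le_iff) linarith+
  qed
  then show ?thesis
    by (rule finite_subset) simp
qed

lemma emeasure_lborel_square:
  fixes a b c :: real
  assumes "c \<ge> 0"
  shows "emeasure lborel ({a..<a + c} \<times> {b..<b + c}) = ennreal (c\<^sup>2)"
proof -
  have "emeasure lborel ({a..<a + c} \<times> {b..<b + c})
      = emeasure lborel {a..<a + c} * emeasure lborel {b..<b + c}"
    by (subst lborel_prod[symmetric], subst lborel.emeasure_pair_measure_Times) auto
  also have "\<dots> = ennreal (c\<^sup>2)"
    using assms by (simp add: power2_eq_square flip: ennreal_mult)
  finally show ?thesis .
qed

text \<open>Rounding a point of the plane down to the lattice \<open>(\<int>/s)\<^sup>2\<close> is constant on half-open squares of side \<open>1/s\<close>,
one for each lattice point. So the count, divided by \<open>s\<^sup>2\<close>, is the integral of the indicator of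
\<open>S\<close> after rounding, and a limit of counts becomes a limit of integrals.\<close>

lemma lattice_count_eq_integral:
  fixes S :: "(real \<times> real) set"
  assumes "bounded S" "s > 0"
  defines "F \<equiv> {(m, n). (real_of_int m / s, real_of_int n / s) \<in> S}"
  defines "R \<equiv> (\<lambda>z. indicator S (real_of_int \<lfloor>s * fst z\<rfloor> / s, real_of_int \<lfloor>s * snd z\<rfloor> / s) :: real)"
  shows "integrable lborel R" "integral\<^sup>L lborel R = real (card F) / s\<^sup>2"
proof -
  define sq where "sq p = {real_of_int (fst p) / s ..< real_of_int (fst p) / s + 1 / s} \<times>
    {real_of_int (snd p) / s ..< real_of_int (snd p) / s + 1 / s}" for p :: "int \<times> int"
  have fin: "finite F"
    unfolding F_def by (rule lattice_points_scaled_finite[OF assms(1,2)])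
  have sq_iff: "z \<in> sq p \<longleftrightarrow> p = (\<lfloor>s * fst z\<rfloor>, \<lfloor>s * snd z\<rfloor>)" for z p
  proof -
    have *: "real_of_int m / s \<le> x \<and> x < real_of_int m / s + 1 / s \<longleftrightarrow> m = \<lfloor>s * x\<rfloor>" for m x
      using assms(2) by (auto simp: field_simps eq_commute[of m] floor_eq_iff)
    show ?thesis
      unfolding sq_def by (cases p; cases z) (use * in auto)
  qed
  have em: "emeasure lborel (sq p) = ennreal (1 / s\<^sup>2)" for p
    unfolding sq_def using emeasure_lborel_square[of "1 / s"] assms(2) by (simp add: power_divide)
  have sets: "sq p \<in> sets lborel" for p
    unfolding sq_def by (simp add: lborel_prod[symmetric])
  have R: "R = (\<lambda>z. \<Sum>p\<in>F. indicator (sq p) z)"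
  proof
    fix z
    have "(\<Sum>p\<in>F. indicator (sq p) z) = (\<Sum>p\<in>F. if p = (\<lfloor>s * fst z\<rfloor>, \<lfloor>s * snd z\<rfloor>) then 1 else 0 :: real)"
      by (intro sum.cong) (auto simp: indicator_def sq_iff)
    also have "\<dots> = R z"
      using fin by (simp add: R_def indicator_def F_def)
    finally show "R z = (\<Sum>p\<in>F. indicator (sq p) z)" ..
  qed
  have int: "integrable lborel (indicator (sq p) :: _ \<Rightarrow> real)" for p
    using sets em by (intro integrable_real_indicator) auto
  show "integrable lborel R"
    unfolding R by (intro Bochner_Integration.integrable_sum int)
  have "integral\<^sup>L lborel R = (\<Sum>p\<in>F. measure lborel (sq p))"
    unfolding R by (subst Bochner_Integration.integral_sum) (use int sets in auto)
  also have "\<dots> = real (card F) / s\<^sup>2"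
    using em by (simp add: measure_def)
  finally show "integral\<^sup>L lborel R = real (card F) / s\<^sup>2" .
qed

lemma floor_scaled_tendsto:
  "((\<lambda>s. real_of_int \<lfloor>s * x\<rfloor> / s) \<longlongrightarrow> x) at_top"
proof (rule real_tendsto_sandwich)
  show "\<forall>\<^sub>F s in at_top. x - 1 / s \<le> real_of_int \<lfloor>s * x\<rfloor> / s"
    using eventually_gt_at_top[of 0]
  proof eventually_elim
    case (elim s)
    have "s * x - 1 \<le> real_of_int \<lfloor>s * x\<rfloor>" by linarith
    then have "(s * x - 1) / s \<le> real_of_int \<lfloor>s * x\<rfloor> / s"
      using elim by (intro divide_right_mono) auto
    then show ?case using elim by (simp add: diff_divide_distrib)
  qed
  show "\<forall>\<^sub>F s in at_top. real_of_int \<lfloor>s * x\<rfloor> / s \<le> x"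
    using eventually_gt_at_top[of 0]
  proof eventually_elim
    case (elim s)
    have "real_of_int \<lfloor>s * x\<rfloor> \<le> s * x" by linarith
    then show ?case using elim by (simp add: field_simps)
  qed
  have "((\<lambda>s. x - 1 / s) \<longlongrightarrow> x - 0) at_top"
    by (intro tendsto_intros tendsto_divide_0[OF tendsto_const] filterlim_at_top_imp_at_infinity filterlim_ident)
  then show "((\<lambda>s. x - 1 / s) \<longlongrightarrow> x) at_top" by simp
qed simp

text \<open>As \<open>s\<close> grows the rounded point tends to the original one, so off the frontier of \<open>S\<close> the rounded
indicator is eventually equal to the indicator of \<open>S\<close>. Dominated convergence then replaces any
estimate of the number of squares that meet the frontier.\<close>

theorem lattice_count_area:
  fixes S :: "(real \<times> real) set"
  assumes "bounded S" and [measurable]: "S \<in> sets borel" and "negligible (frontier S)"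
  shows "((\<lambda>s. real (card {(m, n). (real_of_int m / s, real_of_int n / s) \<in> S}) / s\<^sup>2)
           \<longlongrightarrow> measure lborel S) at_top"
proof -
  define P where "P s z = (real_of_int \<lfloor>s * fst z\<rfloor> / s, real_of_int \<lfloor>s * snd z\<rfloor> / s)"
    for s :: real and z :: "real \<times> real"
  obtain r where r: "\<And>z. z \<in> S \<Longrightarrow> norm z \<le> r"
    using assms(1) by (auto simp: bounded_iff)
  have lim_P: "((\<lambda>s. P s z) \<longlongrightarrow> z) at_top" for z
    using tendsto_Pair[OF floor_scaled_tendsto[of "fst z"] floor_scaled_tendsto[of "snd z"]]
    by (simp add: P_def)
  have "((\<lambda>s. integral\<^sup>L lborel (\<lambda>z. indicator S (P s z) :: real))
      \<longlongrightarrow> integral\<^sup>L lborel (indicator S)) at_top"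
  proof (rule integral_dominated_convergence_at_top)
    \<comment> \<open>For \<open>s \<ge> 1\<close> rounding moves a point by at most \<open>2\<close>, hence the radius \<open>r + 2\<close> of the dominating ball.\<close>
    show "integrable lborel (indicator (cball (0::real\<times>real) (r + 2)) :: _ \<Rightarrow> real)"
      using emeasure_bounded_finite[OF bounded_cball[of "0::real\<times>real" "r + 2"]]
      by (intro integrable_real_indicator) simp_all
    show "(indicator S :: _ \<Rightarrow> real) \<in> borel_measurable lborel" by simp
    show "(\<lambda>z. indicator S (P s z) :: real) \<in> borel_measurable lborel" for s
      unfolding P_def by (simp add: lborel_prod[symmetric]) measurable
    have "frontier S \<in> null_sets lborel"
      using assms(3) by (simp add: negligible_iff_null_sets null_sets_completion_iff)
    then have "AE z in lborel. z \<notin> frontier S"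
      by (rule AE_not_in)
    then show "AE z in lborel. ((\<lambda>s. indicator S (P s z) :: real) \<longlongrightarrow> indicator S z) at_top"
    proof eventually_elim
      case (elim z)
      then consider "z \<in> interior S" | "z \<in> - closure S"
        by (auto simp: frontier_def)
      then have "\<forall>\<^sub>F s in at_top. (indicator S (P s z) :: real) = indicator S z"
      proof cases
        case 1
        then have "\<forall>\<^sub>F s in at_top. P s z \<in> interior S"
          using lim_P[of z] by (rule topological_tendstoD[rotated 2]) simp
        then show ?thesis
          by eventually_elim (use 1 interior_subset in \<open>auto simp: indicator_def\<close>)
      next
        case 2
        then have "\<forall>\<^sub>F s in at_top. P s z \<in> - closure S"
          using lim_P[of z] by (rule topological_tendstoD[rotated 2]) auto
        then show ?thesis
          by eventually_elim (use 2 closure_subset in \<open>auto simp: indicator_def\<close>)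
      qed
      then show ?case
        by (rule tendsto_eventually)
    qed
    show "\<forall>\<^sub>F s in at_top. AE z in lborel.
        norm (indicator S (P s z) :: real) \<le> indicator (cball 0 (r + 2)) z"
      using eventually_ge_at_top[of 1]
    proof eventually_elim
      case (elim s)
      have "norm z \<le> r + 2" if "P s z \<in> S" for z
      proof -
        have *: "\<bar>x - real_of_int \<lfloor>s * x\<rfloor> / s\<bar> \<le> 1" for x
        proof -
          have "\<bar>s * x - real_of_int \<lfloor>s * x\<rfloor>\<bar> \<le> 1" by linarith
          also have "s * x - real_of_int \<lfloor>s * x\<rfloor> = s * (x - real_of_int \<lfloor>s * x\<rfloor> / s)"
            using elim by (simp add: field_simps)
          finally have "s * \<bar>x - real_of_int \<lfloor>s * x\<rfloor> / s\<bar> \<le> 1"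
            using elim by (simp add: abs_mult)
          then show ?thesis
            using elim mult_right_mono[of 1 s "\<bar>x - real_of_int \<lfloor>s * x\<rfloor> / s\<bar>"] by simp
        qed
        have "norm (z - P s z) \<le> norm (fst (z - P s z)) + norm (snd (z - P s z))"
          using norm_Pair_le[of "fst (z - P s z)" "snd (z - P s z)"] unfolding prod.collapse .
        also have "\<dots> \<le> 1 + 1"
          using *[of "fst z"] *[of "snd z"] by (intro add_mono) (simp_all add: P_def)
        finally have "norm (z - P s z) \<le> 2" by simp
        with r[OF that] show ?thesis
          using norm_triangle_sub[of z "P s z"] by linarith
      qed
      then show ?case
        by (auto simp: indicator_def)
    qed
  qed
  moreover have "integral\<^sup>L lborel (indicator S :: _ \<Rightarrow> real) = measure lborel S"
    by simp
  moreover have "\<forall>\<^sub>F s in at_top. integral\<^sup>L lborel (\<lambda>z. indicator S (P s z) :: real)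
      = real (card {(m, n). (real_of_int m / s, real_of_int n / s) \<in> S}) / s\<^sup>2"
    using eventually_gt_at_top[of 0]
    by eventually_elim (use lattice_count_eq_integral(2)[OF assms(1)] in \<open>simp add: P_def\<close>)
  ultimately show ?thesis
    using tendsto_cong by force
qed

section \<open>The proportion of primitive lattice points\<close>

text \<open>This takes the place of Moebius inversion. Subtracting the expected limit, one may take \<open>c = 0\<close>.
The term of index \<open>0\<close> in the series is \<open>f s\<close> itself, and the remaining weights \<open>1/4 + 1/9 + \<dots>\<close> add up to
\<open>q = \<pi>\<^sup>2/6 - 1 < 1\<close>. So an eventual bound \<open>M\<close> for \<open>\<bar>f\<bar>\<close> improves to the eventual bound
\<open>q M + e\<close> for each \<open>e > 0\<close>, which forces the least eventual bound to be \<open>0\<close>. Boundedness of \<open>f\<close> on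
all positive arguments is needed for the tail of the series, where \<open>s / (d + 1)\<close> need not be large.\<close>

lemma bounded_zeta2_transform_inversion:
  fixes f g :: "real \<Rightarrow> real"
  assumes bound: "\<And>s. s > 0 \<Longrightarrow> \<bar>f s\<bar> \<le> K"
    and sums: "\<And>s. s > 0 \<Longrightarrow> (\<lambda>d. f (s / (real d + 1)) / (real d + 1)\<^sup>2) sums g s"
    and lim: "(g \<longlongrightarrow> c) at_top"
  shows "(f \<longlongrightarrow> 6 * c / pi\<^sup>2) at_top"
proof -
  define q where "q = pi\<^sup>2 / 6 - 1"
  define h where "h s = f s - 6 * c / pi\<^sup>2" for s
  define K' where "K' = K + \<bar>6 * c / pi\<^sup>2\<bar>"
  define w where "w d = 1 / (real d + 2)\<^sup>2" for d :: nat
  define Ms where "Ms = {M. M \<ge> 0 \<and> (\<forall>\<^sub>F s in at_top. \<bar>h s\<bar> \<le> M)}"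
  have zeta: "(\<lambda>d. 1 / (real d + 1)\<^sup>2) sums (pi\<^sup>2 / 6)"
    using inverse_squares_sums by (simp add: add.commute)
  have w_sums: "w sums q"
    using zeta sums_split_initial_segment[OF zeta, of 1] by (simp add: w_def [abs_def] q_def add.commute)
  have w_pos: "w d > 0" for d
    by (simp add: w_def)
  have q: "q < 1" "q \<ge> 0"
  proof -
    have "pi * pi < 3.2 * 3.2"
      using pi_approx pi_gt_zero by (intro mult_strict_mono) auto
    then show "q < 1" by (simp add: q_def power2_eq_square)
    show "q \<ge> 0"
      using w_sums w_pos by (metis less_imp_le sums_unique suminf_nonneg sums_summable)
  qed
  have h_bound: "\<bar>h s\<bar> \<le> K'" if "s > 0" for s
    using bound[OF that] unfolding h_def K'_def by linarith
  have K': "K' \<ge> 0" using h_bound[of 1] by simp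
  have h_sums: "(\<lambda>d. h (s / (real d + 2)) * w d) sums (g s - c - h s)" if "s > 0" for s
  proof -
    have "(\<lambda>d. f (s / (real d + 1)) / (real d + 1)\<^sup>2 - 6 * c / pi\<^sup>2 * (1 / (real d + 1)\<^sup>2))
        sums (g s - 6 * c / pi\<^sup>2 * (pi\<^sup>2 / 6))"
      by (intro sums_diff sums[OF that] sums_mult zeta)
    then have "(\<lambda>d. h (s / (real d + 1)) / (real d + 1)\<^sup>2) sums (g s - c)"
      by (simp add: h_def diff_divide_distrib)
    from sums_split_initial_segment[OF this, of 1] show ?thesis
      by (simp add: w_def add.commute)
  qed
  \<comment> \<open>The contraction. The first \<open>n\<close> terms see arguments so large that \<open>M\<close> bounds \<open>h\<close> there; on the
    other terms only the global bound \<open>K'\<close> is available, but their total weight is small.\<close>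
  have step: "\<forall>\<^sub>F s in at_top. \<bar>h s\<bar> \<le> q * M + e" if M: "M \<in> Ms" and e: "e > 0" for M e
  proof -
    obtain T where T: "\<And>s. s \<ge> T \<Longrightarrow> \<bar>h s\<bar> \<le> M"
      using M by (auto simp: Ms_def eventually_at_top_linorder)
    have "(\<lambda>n. \<Sum>d. w (d + n)) \<longlonglongrightarrow> 0"
      using suminf_exist_split2[OF sums_summable[OF w_sums]] .
    then have "(\<lambda>n. K' * (\<Sum>d. w (d + n))) \<longlonglongrightarrow> K' * 0"
      by (rule tendsto_mult_left)
    then have "\<forall>\<^sub>F n in sequentially. K' * (\<Sum>d. w (d + n)) < e / 2"
      using e by (intro order_tendstoD) auto
    then obtain n where n: "K' * (\<Sum>d. w (d + n)) < e / 2"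
      by (auto simp: eventually_sequentially)
    define v where "v d = (if d < n then 0 else w d)" for d
    have "v sums (\<Sum>d. w (d + n))"
    proof -
      have "(\<lambda>d. v (d + n)) sums (\<Sum>d. w (d + n))"
        using summable_ignore_initial_segment[OF sums_summable[OF w_sums], of n]
        by (simp add: v_def summable_sums)
      then show ?thesis
        by (subst (asm) sums_iff_shift) (simp add: v_def)
    qed
    then have major: "(\<lambda>d. M * w d + K' * v d) sums (M * q + K' * (\<Sum>d. w (d + n)))"
      by (intro sums_add sums_mult w_sums)
    have "\<forall>\<^sub>F s in at_top. \<bar>g s - c\<bar> < e / 2"
      using tendstoD[OF lim, of "e / 2"] e by (simp add: dist_real_def)
    then show ?thesis
      using eventually_gt_at_top[of 0] eventually_ge_at_top[of "\<bar>T\<bar> * (real n + 2)"]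
    proof eventually_elim
      case (elim s)
      have le: "\<bar>h (s / (real d + 2)) * w d\<bar> \<le> M * w d + K' * v d" for d
      proof (cases "d < n")
        case True
        have "T * (real d + 2) \<le> \<bar>T\<bar> * (real n + 2)"
          using True by (intro mult_mono) auto
        then have "T \<le> s / (real d + 2)"
          using elim by (simp add: field_simps)
        from T[OF this] show ?thesis
          using True w_pos[of d] by (simp add: v_def abs_mult)
      next
        case False
        have "\<bar>h (s / (real d + 2))\<bar> * w d \<le> K' * w d"
          using h_bound[of "s / (real d + 2)"] elim w_pos[of d] by (intro mult_right_mono) auto
        moreover have "0 \<le> M * w d" using M w_pos[of d] by (simp add: Ms_def)
        ultimately have "\<bar>h (s / (real d + 2))\<bar> * w d \<le> M * w d + K' * w d" by linarith
        then show ?thesis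
          using False w_pos[of d] by (simp add: v_def abs_mult)
      qed
      have summ: "summable (\<lambda>d. \<bar>h (s / (real d + 2)) * w d\<bar>)"
        by (rule summable_comparison_test'[OF sums_summable[OF major], of 0]) (use le in simp)
      have "\<bar>g s - c - h s\<bar> = \<bar>\<Sum>d. h (s / (real d + 2)) * w d\<bar>"
        using sums_unique[OF h_sums] elim by simp
      also have "\<dots> \<le> (\<Sum>d. \<bar>h (s / (real d + 2)) * w d\<bar>)"
        by (rule summable_rabs[OF summ])
      also have "\<dots> \<le> (\<Sum>d. M * w d + K' * v d)"
        by (rule suminf_le[OF le summ sums_summable[OF major]])
      also have "\<dots> = M * q + K' * (\<Sum>d. w (d + n))"
        by (rule sums_unique[OF major, symmetric])
      also have "\<dots> = q * M + K' * (\<Sum>d. w (d + n))"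
        by (simp add: mult.commute)
      finally show ?case
        using elim(1) n by linarith
    qed
  qed
  have Ms: "K' \<in> Ms" "bdd_below Ms"
    using K' eventually_mono[OF eventually_gt_at_top[of "0::real"] h_bound]
    by (auto simp: Ms_def)
  define m where "m = Inf Ms"
  have "m \<ge> 0"
    unfolding m_def using Ms by (intro cInf_greatest) (auto simp: Ms_def)
  have "\<not> m > 0"
  proof
    assume "m > 0"
    define e where "e = (1 - q) * m / 4"
    have "e > 0" using \<open>m > 0\<close> q by (simp add: e_def)
    then obtain M where M: "M \<in> Ms" "M < m + e"
      using cInf_lessD[of Ms "m + e"] Ms by (auto simp: m_def)
    have "q * M + e \<in> Ms"
      using step[OF M(1) \<open>e > 0\<close>] M(1) q \<open>e > 0\<close> by (simp add: Ms_def)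
    then have "m \<le> q * M + e"
      unfolding m_def using Ms(2) by (rule cInf_lower)
    also have "\<dots> \<le> q * (m + e) + e"
      using M q by (intro add_right_mono mult_left_mono) auto
    also have "\<dots> \<le> q * m + 2 * e"
      using q \<open>e > 0\<close> mult_right_mono[of q 1 e] by (simp add: algebra_simps)
    also have "\<dots> = m - 2 * e" by (simp add: e_def field_simps)
    finally show False using \<open>e > 0\<close> by simp
  qed
  with \<open>m \<ge> 0\<close> have "m = 0" by simp
  have "(h \<longlongrightarrow> 0) at_top"
  proof (rule tendstoI)
    fix e :: real assume "e > 0"
    then obtain M where M: "M \<in> Ms" "M < e"
      using cInf_lessD[of Ms e] Ms \<open>m = 0\<close> by (auto simp: m_def)
    then have "\<forall>\<^sub>F s in at_top. \<bar>h s\<bar> \<le> M" by (simp add: Ms_def)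
    then show "\<forall>\<^sub>F s in at_top. dist (h s) 0 < e"
      by eventually_elim (use M in simp)
  qed
  then have "((\<lambda>s. h s + 6 * c / pi\<^sup>2) \<longlongrightarrow> 0 + 6 * c / pi\<^sup>2) at_top"
    by (intro tendsto_intros)
  then show ?thesis by (simp add: h_def)
qed

definition prim_points :: "(real \<times> real) set \<Rightarrow> real \<Rightarrow> (int \<times> int) set" where
  "prim_points S s = {(m, n). coprime m n \<and> (real_of_int m / s, real_of_int n / s) \<in> S}"

lemma nonzero_lattice_point_bounds:
  assumes S: "\<forall>z\<in>S. norm z \<le> r" "(0, 0) \<notin> S" and s: "s > 0"
    and z: "(real_of_int m / s, real_of_int n / s) \<in> S"
  shows "\<bar>real_of_int m\<bar> \<le> r * s" "\<bar>real_of_int n\<bar> \<le> r * s"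
    "gcd m n > 0" "real_of_int (gcd m n) \<le> r * s"
proof -
  have "norm (real_of_int m / s) \<le> r" "norm (real_of_int n / s) \<le> r"
    using S(1)[rule_format, OF z] norm_fst_le[of "real_of_int m / s" "real_of_int n / s"]
      norm_snd_le[of "real_of_int n / s" "real_of_int m / s"] by linarith+
  then show mn: "\<bar>real_of_int m\<bar> \<le> r * s" "\<bar>real_of_int n\<bar> \<le> r * s"
    using s by (auto simp: field_simps)
  have nz: "m \<noteq> 0 \<or> n \<noteq> 0" using S(2) z by auto
  then show "gcd m n > 0" by simp
  have "gcd m n \<le> \<bar>m\<bar> \<or> gcd m n \<le> \<bar>n\<bar>"
    using nz zdvd_imp_le[of "gcd m n" "\<bar>m\<bar>"] zdvd_imp_le[of "gcd m n" "\<bar>n\<bar>"] by auto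
  then show "real_of_int (gcd m n) \<le> r * s" using mn by linarith
qed

text \<open>Dividing by the greatest common divisor \<open>d + 1\<close> turns a lattice point of the dilate by \<open>s\<close> into a
primitive point of the dilate by \<open>s / (d + 1)\<close>. The index is shifted so that it runs over all of \<open>nat\<close>.\<close>

lemma card_gcd_fibre:
  assumes "s > 0"
  shows "card {z \<in> {(m, n). (real_of_int m / s, real_of_int n / s) \<in> S}. gcd (fst z) (snd z) = int d + 1}
    = card (prim_points S (s / (real d + 1)))" (is "card ?L = card ?R")
proof (rule sym, rule bij_betw_same_card[of "\<lambda>(m, n). ((int d + 1) * m, (int d + 1) * n)"])
  let ?f = "\<lambda>(m, n). ((int d + 1) * m, (int d + 1) * n)"
  have scale: "real_of_int ((int d + 1) * m) / s = real_of_int m / (s / (real d + 1))" for m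
    by simp
  have gcd: "gcd ((int d + 1) * m) ((int d + 1) * n) = (int d + 1) * gcd m n" for m n
    by (simp add: gcd_mult_left)
  show "bij_betw ?f ?R ?L"
    unfolding bij_betw_def
  proof
    show "inj_on ?f ?R" by (auto simp: inj_on_def)
    show "?f ` ?R = ?L"
    proof (intro equalityI subsetI)
      fix z assume "z \<in> ?f ` ?R"
      then obtain y where y: "y \<in> ?R" "z = ?f y" by blast
      obtain m n where "y = (m, n)" by (cases y)
      with y have z: "z = ((int d + 1) * m, (int d + 1) * n)" and mn: "coprime m n"
        "(real_of_int m / (s / (real d + 1)), real_of_int n / (s / (real d + 1))) \<in> S"
        by (simp_all only: prim_points_def mem_Collect_eq case_prod_conv)
      have "gcd ((int d + 1) * m) ((int d + 1) * n) = int d + 1"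
        unfolding gcd using mn(1) by (simp add: coprime_iff_gcd_eq_1)
      with mn(2) show "z \<in> ?L"
        unfolding z mem_Collect_eq case_prod_conv fst_conv snd_conv scale by simp
    next
      fix z assume z: "z \<in> ?L"
      obtain m n where mn: "z = (m, n)" by (cases z)
      with z have g: "gcd m n = int d + 1" by simp
      then obtain m' n' where m'n': "m = (int d + 1) * m'" "n = (int d + 1) * n'"
        using gcd_dvd1[of m n] gcd_dvd2[of m n] unfolding g by (elim dvdE)
      have "coprime m' n'"
        using g gcd[of m' n'] m'n' by (simp add: coprime_iff_gcd_eq_1)
      then have "(m', n') \<in> ?R"
        using z unfolding mn m'n' prim_points_def mem_Collect_eq case_prod_conv fst_conv snd_conv scale by simp
      then show "z \<in> ?f ` ?R"
        unfolding mn m'n' by (intro image_eqI[where x = "(m', n')"]) simp_all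
    qed
  qed
qed

text \<open>The proportion of primitive points is \<open>1/\<zeta>(2) = 6/\<pi>\<^sup>2\<close>: sorting all lattice points by their greatest
common divisor writes their normalised count as the \<open>\<zeta>(2)\<close>-weighted series of the normalised primitive
counts, and the inversion lemma solves for the latter. The origin has greatest common divisor \<open>0\<close>, so it
must be kept out of \<open>S\<close>.\<close>

theorem primitive_lattice_count_area:
  fixes S :: "(real \<times> real) set"
  assumes "bounded S" and "S \<in> sets borel" and "negligible (frontier S)" and zero: "(0, 0) \<notin> S"
  shows "((\<lambda>s. real (card (prim_points S s)) / s\<^sup>2) \<longlongrightarrow> 6 * measure lborel S / pi\<^sup>2) at_top"
proof -
  define L where "L s = {(m, n). (real_of_int m / s, real_of_int n / s) \<in> S}" for s
  obtain r where r: "\<forall>z\<in>S. norm z \<le> r"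
    using assms(1) by (auto simp: bounded_iff)
  note bounds = nonzero_lattice_point_bounds[OF r zero]
  have fin: "finite (L s)" if "s > 0" for s
    unfolding L_def by (rule lattice_points_scaled_finite[OF assms(1) that])
  show ?thesis
  proof (rule bounded_zeta2_transform_inversion)
    show "((\<lambda>s. real (card (L s)) / s\<^sup>2) \<longlongrightarrow> measure lborel S) at_top"
      unfolding L_def by (rule lattice_count_area[OF assms(1-3)])
  next
    fix s :: real assume s: "s > 0"
    \<comment> \<open>The normalised count is bounded even for small \<open>s\<close>: as soon as a nonzero point exists, \<open>r s \<ge> 1\<close>,
      and a square of half-side \<open>k \<le> r s\<close> holds \<open>(2 k + 1)\<^sup>2 \<le> (3 r s)\<^sup>2\<close> points.\<close>
    have "real (card (prim_points S s)) \<le> 9 * r\<^sup>2 * s\<^sup>2"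
    proof (cases "prim_points S s = {}")
      case False
      then obtain m n where "(real_of_int m / s, real_of_int n / s) \<in> S"
        by (auto simp: prim_points_def)
      from bounds(3,4)[OF s this] have rs: "r * s \<ge> 1"
        by linarith
      define k where "k = \<lfloor>r * s\<rfloor>"
      have k: "k \<ge> 1" "real_of_int k \<le> r * s" using rs by (simp_all add: k_def)
      have "prim_points S s \<subseteq> {-k..k} \<times> {-k..k}"
      proof clarify
        fix m n assume "(m, n) \<in> prim_points S s"
        then have "(real_of_int m / s, real_of_int n / s) \<in> S"
          by (simp add: prim_points_def)
        from bounds(1,2)[OF s this]
        have "\<bar>m\<bar> \<le> k" "\<bar>n\<bar> \<le> k" unfolding k_def by (simp_all add: le_floor_iff)
        then show "m \<in> {-k..k} \<and> n \<in> {-k..k}" by auto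
      qed
      then have "card (prim_points S s) \<le> card ({-k..k} \<times> {-k..k})"
        by (intro card_mono) auto
      also have "\<dots> = nat (2 * k + 1) * nat (2 * k + 1)"
        by (simp add: card_cartesian_product)
      finally have "real (card (prim_points S s)) \<le> real (nat (2 * k + 1) * nat (2 * k + 1))"
        by (simp only: of_nat_le_iff)
      also have "\<dots> = (2 * real_of_int k + 1)\<^sup>2"
        using k by (simp add: power2_eq_square)
      also have "\<dots> \<le> (3 * (r * s))\<^sup>2"
        using k rs by (intro power_mono) auto
      finally show ?thesis by (simp add: power_mult_distrib)
    qed simp
    then show "\<bar>real (card (prim_points S s)) / s\<^sup>2\<bar> \<le> 9 * r\<^sup>2"
      using s by (simp add: field_simps)
    have rescale: "x / s\<^sup>2 = x / (s / q)\<^sup>2 / q\<^sup>2" if "q > 0" for x q :: real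
      using that by (simp add: power_divide)
    define M where "M = nat \<lceil>r * s\<rceil>"
    have gcd_range: "gcd (fst z) (snd z) \<in> (\<lambda>d. int d + 1) ` {..<M}" if "z \<in> L s" for z
    proof -
      have "(real_of_int (fst z) / s, real_of_int (snd z) / s) \<in> S"
        using that by (auto simp: L_def)
      from bounds(3,4)[OF s this] have "gcd (fst z) (snd z) > 0" "gcd (fst z) (snd z) \<le> \<lceil>r * s\<rceil>" "r * s > 0"
        by linarith+
      then show ?thesis
        by (intro image_eqI[where x = "nat (gcd (fst z) (snd z) - 1)"]) (auto simp: M_def)
    qed
    have fibre: "card {z \<in> L s. gcd (fst z) (snd z) = int d + 1} = card (prim_points S (s / (real d + 1)))" for d
      unfolding L_def by (rule card_gcd_fibre[OF s])
    have "card (L s) = (\<Sum>y\<in>(\<lambda>d. int d + 1) ` {..<M}. card {z \<in> L s. gcd (fst z) (snd z) = y})"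
      unfolding card_eq_sum by (rule sum.group[symmetric]) (use fin[OF s] gcd_range in auto)
    also have "\<dots> = (\<Sum>d<M. card (prim_points S (s / (real d + 1))))"
      by (subst sum.reindex) (auto simp: inj_on_def fibre)
    finally have card_L: "card (L s) = (\<Sum>d<M. card (prim_points S (s / (real d + 1))))" .
    have zero_beyond: "card (prim_points S (s / (real d + 1))) = 0" if "d \<notin> {..<M}" for d
    proof -
      have empty: "{z \<in> L s. gcd (fst z) (snd z) = int d + 1} = {}"
        using gcd_range that by force
      show ?thesis unfolding fibre[symmetric] empty by (rule card.empty)
    qed
    have "(\<lambda>d. real (card (prim_points S (s / (real d + 1)))) / s\<^sup>2)
        sums (\<Sum>d<M. real (card (prim_points S (s / (real d + 1)))) / s\<^sup>2)"
    proof (rule sums_finite)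
      fix d assume "d \<notin> {..<M}"
      from zero_beyond[OF this] show "real (card (prim_points S (s / (real d + 1)))) / s\<^sup>2 = 0"
        by (simp only: of_nat_0 div_0)
    qed simp
    also have "(\<Sum>d<M. real (card (prim_points S (s / (real d + 1)))) / s\<^sup>2) = real (card (L s)) / s\<^sup>2"
      by (simp add: card_L sum_divide_distrib)
    also have "(\<lambda>d. real (card (prim_points S (s / (real d + 1)))) / s\<^sup>2)
        = (\<lambda>d. real (card (prim_points S (s / (real d + 1)))) / (s / (real d + 1))\<^sup>2 / (real d + 1)\<^sup>2)"
      by (rule ext, rule rescale) simp
    finally show "(\<lambda>d. real (card (prim_points S (s / (real d + 1)))) / (s / (real d + 1))\<^sup>2 / (real d + 1)\<^sup>2)
        sums (real (card (L s)) / s\<^sup>2)" .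
  qed
qed

section \<open>A region bounded by two lines and two hyperbolas\<close>

text \<open>In the coordinates \<open>\<xi> = p \<bullet> z\<close> and \<open>\<eta> = q \<bullet> z\<close> this is a fundamental domain for
\<open>(\<xi>, \<eta>) \<mapsto> (E \<xi>, \<eta> / E)\<close> acting on \<open>\<xi> > 0\<close>, \<open>\<bar>\<xi> \<eta>\<bar> \<le> k\<close>. Bounding \<open>\<xi>\<close> rather than the ratio
\<open>\<xi> / \<eta>\<close> makes the area a single integral of \<open>2 k / \<xi>\<close>.\<close>

definition hyp_sector :: "real \<times> real \<Rightarrow> real \<times> real \<Rightarrow> real \<Rightarrow> real \<Rightarrow> (real \<times> real) set" where
  "hyp_sector p q E k = {z. 1 \<le> p \<bullet> z \<and> p \<bullet> z < E \<and> \<bar>(p \<bullet> z) * (q \<bullet> z)\<bar> \<le> k}"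

lemma hyp_sector_borel: "hyp_sector p q E k \<in> sets borel"
  unfolding hyp_sector_def by measurable

text \<open>Each ray from the origin meets a level set of a nonconstant homogeneous function at a nonzero value at
most once, and closed sets of this kind are null. The same argument handles lines and hyperbolas.\<close>

lemma negligible_inner_level:
  fixes p :: "'a::euclidean_space"
  assumes "c \<noteq> 0"
  shows "negligible {z. p \<bullet> z = c}"
proof (rule starlike_negligible_strong[where a = 0])
  show "closed {z. p \<bullet> z = c}" by (rule closed_hyperplane)
qed (use assms in auto)

lemma negligible_frontier_hyp_sector:
  assumes "E > 1" "k > 0"
  shows "negligible (frontier (hyp_sector p q E k))"
proof -
  let ?Q = "\<lambda>z. \<bar>(p \<bullet> z) * (q \<bullet> z)\<bar>"
  have "closure (hyp_sector p q E k) \<subseteq> {z. 1 \<le> p \<bullet> z \<and> p \<bullet> z \<le> E \<and> ?Q z \<le> k}"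
    by (rule closure_minimal)
      (auto simp: hyp_sector_def intro!: closed_Collect_conj closed_Collect_le continuous_intros)
  moreover have "{z. 1 < p \<bullet> z \<and> p \<bullet> z < E \<and> ?Q z < k} \<subseteq> interior (hyp_sector p q E k)"
    by (rule interior_maximal)
      (auto simp: hyp_sector_def intro!: open_Collect_conj open_Collect_less continuous_intros)
  ultimately have "frontier (hyp_sector p q E k) \<subseteq> {z. p \<bullet> z = 1} \<union> {z. p \<bullet> z = E} \<union> {z. ?Q z = k}"
    unfolding frontier_def by force
  moreover have "negligible {z. ?Q z = k}"
  proof (rule starlike_negligible_strong[where a = 0])
    show "closed {z. ?Q z = k}"
      by (intro closed_Collect_eq continuous_intros)
    fix c :: real and z assume c: "0 \<le> c" "c < 1" and z: "0 + z \<in> {z. ?Q z = k}"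
    have "?Q (c *\<^sub>R z) = c\<^sup>2 * k"
      using z by (auto simp: abs_mult power2_eq_square)
    also have "\<dots> < 1 * k"
      using c assms(2) by (intro mult_strict_right_mono) (auto simp: power2_eq_square mult_le_one
        intro: mult_strict_mono[of c 1 c 1, simplified])
    finally show "0 + c *\<^sub>R z \<notin> {z. ?Q z = k}" by simp
  qed
  ultimately show ?thesis
    using assms(1) by (elim negligible_subset[rotated]) (intro negligible_Un negligible_inner_level; simp)
qed

lemma bounded_hyp_sector:
  assumes "fst p * snd q - snd p * fst q \<noteq> 0"
  shows "bounded (hyp_sector p q E k)"
proof -
  let ?D = "fst p * snd q - snd p * fst q"
  define r where "r = (\<bar>snd q\<bar> * E + \<bar>snd p\<bar> * k + \<bar>fst q\<bar> * E + \<bar>fst p\<bar> * k) / \<bar>?D\<bar>"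
  have "norm z \<le> r" if z: "z \<in> hyp_sector p q E k" for z
  proof -
    define X where "X = p \<bullet> z"
    define Y where "Y = q \<bullet> z"
    have X: "1 \<le> X" "X < E" "\<bar>X * Y\<bar> \<le> k" using z by (auto simp: hyp_sector_def X_def Y_def)
    have "1 * \<bar>Y\<bar> \<le> X * \<bar>Y\<bar>" using X by (intro mult_right_mono) auto
    then have Y: "\<bar>Y\<bar> \<le> k" using X by (simp add: abs_mult)
    have D: "?D * fst z = snd q * X - snd p * Y" "?D * snd z = fst p * Y - fst q * X"
      by (auto simp: X_def Y_def inner_prod_def algebra_simps)
    have "\<bar>?D\<bar> * norm z \<le> \<bar>?D\<bar> * (\<bar>fst z\<bar> + \<bar>snd z\<bar>)"
      using norm_Pair_le[of "fst z" "snd z"] by (intro mult_left_mono) auto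
    also have "\<dots> = \<bar>snd q * X - snd p * Y\<bar> + \<bar>fst p * Y - fst q * X\<bar>"
      by (simp add: distrib_left flip: abs_mult D)
    also have "\<dots> \<le> (\<bar>snd q * X\<bar> + \<bar>snd p * Y\<bar>) + (\<bar>fst p * Y\<bar> + \<bar>fst q * X\<bar>)"
      by linarith
    also have "\<dots> \<le> (\<bar>snd q\<bar> * E + \<bar>snd p\<bar> * k) + (\<bar>fst p\<bar> * k + \<bar>fst q\<bar> * E)"
      unfolding abs_mult using X Y by (intro add_mono mult_left_mono) auto
    finally show ?thesis
      using assms by (simp add: r_def field_simps)
  qed
  then show ?thesis
    unfolding bounded_iff by blast
qed

text \<open>Two affine substitutions in one variable each, separated by an exchange of the order of integration,
replace the linear change of coordinates \<open>(x, y) \<mapsto> (\<xi>, \<eta>)\<close>: first \<open>x\<close> gives way to \<open>\<xi>\<close> for fixed \<open>y\<close>,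
then \<open>y\<close> to \<open>\<eta>\<close> for fixed \<open>\<xi>\<close>. The remaining integral is that of \<open>2 k / \<xi>\<close> over \<open>[1, E]\<close>.\<close>

lemma emeasure_hyp_sector:
  assumes a: "fst p \<noteq> 0" and D: "fst p * snd q - snd p * fst q \<noteq> 0" and "E > 1" and k: "k > 0"
  shows "emeasure lborel (hyp_sector p q E k)
    = ennreal (2 * k * ln E / \<bar>fst p * snd q - snd p * fst q\<bar>)"
proof -
  let ?a = "fst p" and ?b = "snd p" and ?c = "fst q" and ?d = "snd q"
  let ?D = "?a * ?d - ?b * ?c"
  define I where "I \<xi> \<eta> = (indicator {1..<E} \<xi> * indicator {z. \<bar>z\<bar> \<le> k} (\<xi> * \<eta>) :: ennreal)" for \<xi> \<eta>
  have I_meas: "(\<lambda>z. I (fst z) (snd z)) \<in> borel_measurable (borel \<Otimes>\<^sub>M borel)"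
    unfolding I_def by measurable
  have [measurable]: "(\<lambda>x. I (u x) (v x)) \<in> borel_measurable M"
    if "u \<in> borel_measurable M" "v \<in> borel_measurable M" for M :: "'b measure" and u v
    using measurable_compose[OF measurable_Pair[OF that] I_meas] by simp
  have "emeasure lborel (hyp_sector p q E k) = (\<integral>\<^sup>+z. I (p \<bullet> z) (q \<bullet> z) \<partial>lborel)"
  proof -
    have "indicator (hyp_sector p q E k) z = I (p \<bullet> z) (q \<bullet> z)" for z
      by (auto simp: I_def hyp_sector_def indicator_def)
    then show ?thesis
      using nn_integral_indicator[of "hyp_sector p q E k" lborel] by (simp add: hyp_sector_borel)
  qed
  also have "\<dots> = (\<integral>\<^sup>+z. I (?a * fst z + ?b * snd z) (?c * fst z + ?d * snd z) \<partial>(lborel \<Otimes>\<^sub>M lborel))"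
    by (simp add: lborel_prod inner_prod_def)
  also have "\<dots> = (\<integral>\<^sup>+y. \<integral>\<^sup>+x. I (?a * x + ?b * y) (?c * x + ?d * y) \<partial>lborel \<partial>lborel)"
    by (subst lborel_pair.nn_integral_snd[symmetric]) (auto simp: case_prod_unfold)
  also have "\<dots> = (\<integral>\<^sup>+y. \<bar>1 / ?a\<bar> * (\<integral>\<^sup>+\<xi>. I \<xi> (?c / ?a * \<xi> + ?D / ?a * y) \<partial>lborel) \<partial>lborel)"
  proof (rule nn_integral_cong)
    fix y
    have eqs: "?a * (- ?b * y / ?a + 1 / ?a * \<xi>) + ?b * y = \<xi>"
        "?c * (- ?b * y / ?a + 1 / ?a * \<xi>) + ?d * y = ?c / ?a * \<xi> + ?D / ?a * y" for \<xi>
      using a by (simp_all add: field_simps)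
    show "(\<integral>\<^sup>+x. I (?a * x + ?b * y) (?c * x + ?d * y) \<partial>lborel)
      = \<bar>1 / ?a\<bar> * (\<integral>\<^sup>+\<xi>. I \<xi> (?c / ?a * \<xi> + ?D / ?a * y) \<partial>lborel)"
      by (subst nn_integral_real_affine[where c = "1 / ?a" and t = "- ?b * y / ?a"])
        (use a in \<open>simp_all only: eqs\<close>, auto)
  qed
  also have "\<dots> = \<bar>1 / ?a\<bar> * (\<integral>\<^sup>+y. \<integral>\<^sup>+\<xi>. I \<xi> (?c / ?a * \<xi> + ?D / ?a * y) \<partial>lborel \<partial>lborel)"
    by (rule nn_integral_cmult) measurable
  also have "(\<integral>\<^sup>+y. \<integral>\<^sup>+\<xi>. I \<xi> (?c / ?a * \<xi> + ?D / ?a * y) \<partial>lborel \<partial>lborel)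
      = (\<integral>\<^sup>+\<xi>. \<integral>\<^sup>+y. I \<xi> (?c / ?a * \<xi> + ?D / ?a * y) \<partial>lborel \<partial>lborel)"
    by (rule lborel_pair.Fubini') measurable
  also have "\<dots> = (\<integral>\<^sup>+\<xi>. ennreal \<bar>?a / ?D\<bar> * (ennreal (2 * k / \<xi>) * indicator {1..E} \<xi>) \<partial>lborel)"
  proof (rule nn_integral_cong_AE)
    \<comment> \<open>The sector is half-open at \<open>\<xi> = E\<close>, the interval of integration closed.\<close>
    have "AE \<xi> in lborel. \<xi> \<noteq> E" by (rule AE_lborel_singleton)
    then show "AE \<xi> in lborel. (\<integral>\<^sup>+y. I \<xi> (?c / ?a * \<xi> + ?D / ?a * y) \<partial>lborel)
      = ennreal \<bar>?a / ?D\<bar> * (ennreal (2 * k / \<xi>) * indicator {1..E} \<xi>)"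
    proof eventually_elim
      case (elim \<xi>)
      have "(\<integral>\<^sup>+y. I \<xi> (?c / ?a * \<xi> + ?D / ?a * y) \<partial>lborel)
        = \<bar>?a / ?D\<bar> * (\<integral>\<^sup>+\<eta>. I \<xi> (?c / ?a * \<xi> + ?D / ?a * (- ?c * \<xi> / ?D + ?a / ?D * \<eta>)) \<partial>lborel)"
        by (rule nn_integral_real_affine) (use a D in auto)
      also have "(\<lambda>\<eta>. I \<xi> (?c / ?a * \<xi> + ?D / ?a * (- ?c * \<xi> / ?D + ?a / ?D * \<eta>))) = I \<xi>"
      proof -
        define D' where "D' = ?D"
        have "D' \<noteq> 0" using D by (simp add: D'_def)
        then have "?c / ?a * \<xi> + D' / ?a * (- ?c * \<xi> / D' + ?a / D' * \<eta>) = \<eta>" for \<eta>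
          using a by (simp add: field_simps)
        then show ?thesis unfolding D'_def by simp
      qed
      also have "(\<integral>\<^sup>+\<eta>. I \<xi> \<eta> \<partial>lborel) = ennreal (2 * k / \<xi>) * indicator {1..E} \<xi>"
      proof (cases "\<xi> \<in> {1..<E}")
        case True
        have "(\<integral>\<^sup>+\<eta>. I \<xi> \<eta> \<partial>lborel) = (\<integral>\<^sup>+\<eta>. indicator {- (k / \<xi>)..k / \<xi>} \<eta> \<partial>lborel)"
          using True by (intro nn_integral_cong) (auto simp: I_def indicator_def abs_le_iff field_simps)
        also have "\<dots> = ennreal (2 * k / \<xi>)"
          using True k by simp
        finally show ?thesis using True by simp
      next
        case False
        then show ?thesis using elim by (auto simp: I_def indicator_def)
      qed
      finally show ?case .
    qed
  qed
  also have "\<dots> = ennreal \<bar>?a / ?D\<bar> * (\<integral>\<^sup>+\<xi>. ennreal (2 * k / \<xi>) * indicator {1..E} \<xi> \<partial>lborel)"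
    by (rule nn_integral_cmult) measurable
  also have "(\<integral>\<^sup>+\<xi>. ennreal (2 * k / \<xi>) * indicator {1..E} \<xi> \<partial>lborel) = ennreal (2 * k * ln E - 2 * k * ln 1)"
    using k \<open>E > 1\<close>
    by (intro nn_integral_FTC_Icc) (auto intro!: derivative_eq_intros)
  also have "ennreal \<bar>1 / ?a\<bar> * (ennreal \<bar>?a / ?D\<bar> * ennreal (2 * k * ln E - 2 * k * ln 1))
      = ennreal (2 * k * ln E / \<bar>?D\<bar>)"
    using a k \<open>E > 1\<close> by (simp add: abs_divide flip: ennreal_mult)
  finally show ?thesis .
qed

section \<open>The Pell equation\<close>

lemma sqrt_irrational_of_nonsquare:
  fixes D :: int
  assumes "D > 0" "\<And>k. D \<noteq> k\<^sup>2"
  shows "sqrt (real_of_int D) \<notin> \<rat>"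
proof
  assume "sqrt (real_of_int D) \<in> \<rat>"
  then obtain a b where ab: "b > 0" "coprime a b" "sqrt (real_of_int D) = of_int a / of_int b"
    by (metis Rats_cases')
  have "real_of_int D = (of_int a / of_int b)\<^sup>2"
    using assms(1) by (simp flip: ab(3))
  then have "real_of_int (D * b\<^sup>2) = real_of_int (a\<^sup>2)"
    using ab(1) by (simp add: field_simps)
  then have eq: "D * b\<^sup>2 = a\<^sup>2" by linarith
  then have "b\<^sup>2 dvd a\<^sup>2" by (metis dvd_triv_right)
  moreover have "coprime (a\<^sup>2) (b\<^sup>2)" using ab(2) by simp
  ultimately have "is_unit (b\<^sup>2)" by (metis coprime_common_divisor dvd_refl)
  then have "b\<^sup>2 = 1" by simp
  with eq assms(2) show False by simp
qed

text \<open>Since \<open>h\<^sup>2 - D k\<^sup>2 = (h - k \<surd>D) (h + k \<surd>D)\<close>, where the first factor is at most \<open>1/k\<close> and the second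
of size about \<open>2 k \<surd>D\<close>, a good rational approximation of \<open>\<surd>D\<close> has a norm bounded in terms of \<open>D\<close> only.\<close>

lemma Pell_small_norm:
  fixes D h k :: int
  assumes D: "D > 0" and k: "k > 0" and close: "\<bar>sqrt (real_of_int D) - of_int h / of_int k\<bar> < 1 / (of_int k)\<^sup>2"
  shows "h > 0" "\<bar>h\<^sup>2 - D * k\<^sup>2\<bar> \<le> \<lceil>2 * sqrt (real_of_int D) + 1\<rceil>"
proof -
  define w where "w = sqrt (real_of_int D)"
  have w: "w\<^sup>2 = D" "w \<ge> 1" using D by (simp_all add: w_def)
  have k1: "real_of_int k \<ge> 1" using k by simp
  have "\<bar>w - h / k\<bar> * k < 1 / (of_int k)\<^sup>2 * k"
    using close k unfolding w_def by (intro mult_strict_right_mono) auto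
  moreover have "\<bar>w - h / k\<bar> * k = \<bar>w * k - h\<bar>"
    using k by (simp add: abs_mult_pos' abs_mult_pos field_simps flip: abs_mult_pos)
  moreover have "1 / (of_int k)\<^sup>2 * k = 1 / real_of_int k"
    using k by (simp add: power2_eq_square)
  ultimately have c: "\<bar>w * k - h\<bar> < 1 / k" by simp
  have k_inv: "1 / real_of_int k \<le> 1" using k1 by simp
  have "w * k \<ge> 1" using w k1 by (metis mult_mono mult_1 zero_le_one order_trans)
  then show h: "h > 0" using c k_inv by linarith
  have "\<bar>of_int h - w * k\<bar> * (h + w * k) \<le> 1 / k * (2 * (w * k) + 1)"
  proof (rule mult_mono)
    show "\<bar>of_int h - w * k\<bar> \<le> 1 / k" using c by (simp add: abs_minus_commute)
    show "of_int h + w * k \<le> 2 * (w * k) + 1" using c k_inv by linarith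
  qed (use h w k in auto)
  also have "\<dots> = 2 * w + 1 / k" using k by (simp add: field_simps)
  also have "\<dots> \<le> 2 * w + 1" using k_inv by simp
  also have "\<bar>of_int h - w * k\<bar> * (h + w * k) = \<bar>(of_int h - w * k) * (h + w * k)\<bar>"
    using h w k by (simp add: abs_mult)
  also have "(of_int h - w * k) * (h + w * k) = real_of_int (h\<^sup>2 - D * k\<^sup>2)"
    by (simp add: algebra_simps power2_eq_square flip: w(1))
  finally have "real_of_int \<bar>h\<^sup>2 - D * k\<^sup>2\<bar> \<le> 2 * w + 1" by simp
  then show "\<bar>h\<^sup>2 - D * k\<^sup>2\<bar> \<le> \<lceil>2 * sqrt (real_of_int D) + 1\<rceil>"
    unfolding w_def by linarith
qed

text \<open>The quotient of \<open>h + k \<surd>D\<close> by \<open>h' + k' \<surd>D\<close> has norm \<open>1\<close>; its coordinates, which a priori have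
denominator \<open>n\<close>, are integral because numerator and denominator agree modulo \<open>n\<close>.\<close>

lemma Pell_quotient:
  fixes D n h k h' k' :: int
  assumes n: "n \<noteq> 0" and norm: "h\<^sup>2 - D * k\<^sup>2 = n" "h'\<^sup>2 - D * k'\<^sup>2 = n"
    and cong: "h mod n = h' mod n" "k mod n = k' mod n"
    and pos: "h > 0" "k > 0" "h' > 0" "k' > 0" and ne: "(h, k) \<noteq> (h', k')"
  shows "\<exists>X Y. Y \<noteq> 0 \<and> X\<^sup>2 - D * Y\<^sup>2 = 1"
proof -
  obtain a b where ab: "h' = h + n * a" "k' = k + n * b"
    using cong by (metis mod_eqE)
  define X where "X = 1 + h * a - D * k * b"
  define Y where "Y = h * b - a * k"
  have X: "h * h' - D * k * k' = n * X"
    using norm(1) by (simp add: X_def ab power2_eq_square algebra_simps)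
  have Y: "h * k' - h' * k = n * Y"
    by (simp add: Y_def ab algebra_simps)
  have "n\<^sup>2 * (X\<^sup>2 - D * Y\<^sup>2) = (h * h' - D * k * k')\<^sup>2 - D * (h * k' - h' * k)\<^sup>2"
    unfolding X Y by (simp add: algebra_simps power2_eq_square)
  also have "\<dots> = (h\<^sup>2 - D * k\<^sup>2) * (h'\<^sup>2 - D * k'\<^sup>2)"
    by (simp add: algebra_simps power2_eq_square)
  also have "\<dots> = n\<^sup>2 * 1" unfolding norm by (simp add: power2_eq_square)
  finally have "X\<^sup>2 - D * Y\<^sup>2 = 1" using n by simp
  moreover have "Y \<noteq> 0"
  proof
    assume "Y = 0"
    then have cross: "h * k' = h' * k" using Y by simp
    have "k'\<^sup>2 * n = (h * k')\<^sup>2 - D * k\<^sup>2 * k'\<^sup>2"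
      by (simp add: algebra_simps power2_eq_square flip: norm(1))
    also have "\<dots> = k\<^sup>2 * n"
      unfolding cross by (simp add: algebra_simps power2_eq_square flip: norm(2))
    finally have "k' = k" using n pos by (simp add: power2_eq_iff)
    with cross ne pos show False by simp
  qed
  ultimately show ?thesis by blast
qed

text \<open>Dirichlet's theorem gives infinitely many pairs of bounded norm. By the pigeonhole principle two of them
share their norm \<open>n\<close> and their residues modulo \<open>n\<close>, so their quotient is a unit \<open>X + Y \<surd>D\<close> of norm \<open>1\<close>;
doubling \<open>X\<close> and \<open>Y\<close> solves the equation with right-hand side \<open>4\<close>.\<close>

theorem Pell_solution_exists:
  fixes D :: int
  assumes D: "D > 0" "\<And>k. D \<noteq> k\<^sup>2"
  shows "\<exists>t u. t > 0 \<and> u > 0 \<and> t\<^sup>2 - D * u\<^sup>2 = 4"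
proof -
  let ?A = "approx_set (sqrt (real_of_int D))"
  define M where "M = \<lceil>2 * sqrt (real_of_int D) + 1\<rceil>"
  define \<Phi> where "\<Phi> = (\<lambda>(h, k). (h\<^sup>2 - D * k\<^sup>2, h mod (h\<^sup>2 - D * k\<^sup>2), k mod (h\<^sup>2 - D * k\<^sup>2)))"
  have A: "k > 0 \<and> h > 0 \<and> \<bar>h\<^sup>2 - D * k\<^sup>2\<bar> \<le> M \<and> h\<^sup>2 - D * k\<^sup>2 \<noteq> 0" if "(h, k) \<in> ?A" for h k
  proof -
    have *: "k > 0" "\<bar>sqrt (real_of_int D) - of_int h / of_int k\<bar> < 1 / (of_int k)\<^sup>2" "coprime h k"
      using that by (auto simp: approx_set_def)
    have "h\<^sup>2 - D * k\<^sup>2 \<noteq> 0"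
    proof
      assume "h\<^sup>2 - D * k\<^sup>2 = 0"
      then have "real_of_int D = (h / k)\<^sup>2"
        using *(1) by (simp add: field_simps) (metis of_int_mult of_int_power mult.commute)
      then have "sqrt D = \<bar>h / k\<bar>" by simp
      then show False
        using sqrt_irrational_of_nonsquare[OF D] by simp
    qed
    with * Pell_small_norm[OF D(1) *(1,2)] show ?thesis by (simp add: M_def)
  qed
  have "\<Phi> ` ?A \<subseteq> {-M..M} \<times> {-M..M} \<times> {-M..M}"
  proof
    fix x assume "x \<in> \<Phi> ` ?A"
    then obtain h k n a b where hk: "(h, k) \<in> ?A" and eq: "x = (n, a, b)" "x = \<Phi> (h, k)"
      by (metis imageE prod_cases3 surj_pair)
    then have n: "n \<noteq> 0" "\<bar>n\<bar> \<le> M" "a = h mod n" "b = k mod n" using A[OF hk] by (auto simp: \<Phi>_def)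
    have "\<bar>a\<bar> \<le> M" "\<bar>b\<bar> \<le> M" using n abs_mod_less[of n h] abs_mod_less[of n k] by auto
    with n eq(1) show "x \<in> {-M..M} \<times> {-M..M} \<times> {-M..M}" by auto
  qed
  then have "finite (\<Phi> ` ?A)" by (rule finite_subset) simp
  moreover have "infinite ?A"
    using sqrt_irrational_of_nonsquare[OF D] rational_iff_finite_approx_set by blast
  ultimately obtain z where z: "z \<in> ?A" "infinite {y \<in> ?A. \<Phi> y = \<Phi> z}"
    using pigeonhole_infinite by blast
  from infinite_imp_nonempty[OF infinite_remove[OF z(2), of z]]
  obtain y where y: "y \<in> ?A" "\<Phi> y = \<Phi> z" "y \<noteq> z" by auto
  obtain h k h' k' where hk: "z = (h, k)" "y = (h', k')" by (cases z, cases y)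
  have "\<exists>X Y. Y \<noteq> 0 \<and> X\<^sup>2 - D * Y\<^sup>2 = 1"
    by (rule Pell_quotient[of "h\<^sup>2 - D * k\<^sup>2" h D k h' k'])
      (use A z(1) y hk in \<open>auto simp: \<Phi>_def\<close>)
  then obtain X Y where XY: "Y \<noteq> 0" "X\<^sup>2 - D * Y\<^sup>2 = 1" by blast
  have "D * Y\<^sup>2 \<ge> 0" using D by simp
  then have "X \<noteq> 0" using XY by auto
  have "(2 * \<bar>X\<bar>)\<^sup>2 - D * (2 * \<bar>Y\<bar>)\<^sup>2 = 4 * (X\<^sup>2 - D * Y\<^sup>2)"
    by (simp add: power_mult_distrib algebra_simps)
  then show ?thesis
    using XY \<open>X \<noteq> 0\<close> by (intro exI[of _ "2 * \<bar>X\<bar>"] exI[of _ "2 * \<bar>Y\<bar>"]) simp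
qed

lemma fundamental_solution:
  fixes D :: int
  assumes D: "D > 0" "\<And>k. D \<noteq> k\<^sup>2"
  shows "is_fundamental_solution D (fundamental_solution D)"
proof -
  define P where "P u \<longleftrightarrow> u > 0 \<and> (\<exists>t>0. t\<^sup>2 - D * (int u)\<^sup>2 = 4)" for u
  obtain t u where "t > 0" "u > 0" "t\<^sup>2 - D * u\<^sup>2 = 4"
    using Pell_solution_exists[OF D] by blast
  then have "P (nat u)" by (auto simp: P_def)
  then have "P (Least P)" by (rule LeastI)
  then obtain t0 where t0: "Least P > 0" "t0 > 0" "t0\<^sup>2 - D * (int (Least P))\<^sup>2 = 4"
    by (auto simp: P_def)
  have least: "int (Least P) \<le> u'" if "t' > 0" "u' > 0" "t'\<^sup>2 - D * u'\<^sup>2 = 4" for t' u'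
  proof -
    have "P (nat u')" using that by (auto simp: P_def)
    then have "Least P \<le> nat u'" by (rule Least_le)
    then show ?thesis using that by linarith
  qed
  show ?thesis
    unfolding fundamental_solution_def
  proof (rule theI[of _ "(t0, int (Least P))"])
    show "is_fundamental_solution D (t0, int (Least P))"
      using t0 least by (auto simp: is_fundamental_solution_def)
    fix p assume "is_fundamental_solution D p"
    then obtain t' u' where p: "p = (t', u')" "t' > 0" "u' > 0" "t'\<^sup>2 - D * u'\<^sup>2 = 4"
      and "u' \<le> int (Least P)"
      using t0 by (cases p) (auto simp: is_fundamental_solution_def)
    then have "u' = int (Least P)" using least by fastforce
    then have "t'\<^sup>2 = t0\<^sup>2" using p(4) t0(3) by (metis diff_add_cancel)
    then have "t' = t0" using p(2) t0(2) by (simp only: power2_eq_iff) linarith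
    with p \<open>u' = _\<close> show "p = (t0, int (Least P))" by simp
  qed
qed

section \<open>Integral automorphs of a binary quadratic form\<close>

lemma matrix_vector_2:
  fixes \<gamma> :: "int ^ 2 ^ 2"
  shows "(\<gamma> *v x) $ 1 = \<gamma> $ 1 $ 1 * x $ 1 + \<gamma> $ 1 $ 2 * x $ 2"
    "(\<gamma> *v x) $ 2 = \<gamma> $ 2 $ 1 * x $ 1 + \<gamma> $ 2 $ 2 * x $ 2"
  by (simp_all add: matrix_vector_mult_def sum_2)

lemma SO_mult: "\<gamma> \<in> SO_bqf A B C \<Longrightarrow> \<delta> \<in> SO_bqf A B C \<Longrightarrow> \<gamma> ** \<delta> \<in> SO_bqf A B C"
  by (simp add: SO_bqf_def SL2Z_def det_mul flip: matrix_vector_mul_assoc)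

lemma SL2Z_inverse:
  assumes "\<gamma> \<in> SL2Z"
  obtains \<delta> where "\<delta> \<in> SL2Z" "\<And>x. \<delta> *v (\<gamma> *v x) = x" "\<And>x. \<gamma> *v (\<delta> *v x) = x"
proof -
  define \<delta> :: "int ^ 2 ^ 2" where
    "\<delta> = vector [vector [\<gamma> $ 2 $ 2, - \<gamma> $ 1 $ 2], vector [- \<gamma> $ 2 $ 1, \<gamma> $ 1 $ 1]]"
  have det: "\<gamma> $ 1 $ 1 * \<gamma> $ 2 $ 2 = 1 + \<gamma> $ 1 $ 2 * \<gamma> $ 2 $ 1"
    using assms by (simp add: SL2Z_def det_2 algebra_simps)
  show thesis
  proof
    show "\<delta> \<in> SL2Z" using det by (simp add: SL2Z_def det_2 \<delta>_def algebra_simps)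
    show "\<delta> *v (\<gamma> *v x) = x" for x
      unfolding vec_eq_iff forall_2 matrix_vector_2 using det by (simp add: \<delta>_def) algebra
    show "\<gamma> *v (\<delta> *v x) = x" for x
      unfolding vec_eq_iff forall_2 matrix_vector_2 using det by (simp add: \<delta>_def) algebra
  qed
qed

lemma SO_inverse:
  assumes "\<gamma> \<in> SO_bqf A B C"
  obtains \<delta> where "\<delta> \<in> SO_bqf A B C" "\<And>x. \<delta> *v (\<gamma> *v x) = x" "\<And>x. \<gamma> *v (\<delta> *v x) = x"
proof -
  have "\<gamma> \<in> SL2Z" and inv: "\<And>x. bqf A B C (\<gamma> *v x) = bqf A B C x" using assms by (auto simp: SO_bqf_def)
  from SL2Z_inverse[OF this(1)] obtain \<delta> where \<delta>: "\<delta> \<in> SL2Z"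
    "\<And>x. \<delta> *v (\<gamma> *v x) = x" "\<And>x. \<gamma> *v (\<delta> *v x) = x" by metis
  have "bqf A B C (\<delta> *v x) = bqf A B C x" for x using inv[of "\<delta> *v x"] \<delta>(3) by simp
  with \<delta> show thesis by (intro that[of \<delta>]) (auto simp: SO_bqf_def)
qed

lemma SO_orbit_invariant:
  assumes "\<gamma> \<in> SO_bqf A B C"
  shows "SO_orbit A B C (\<gamma> *v x) = SO_orbit A B C x"
proof
  show "SO_orbit A B C (\<gamma> *v x) \<subseteq> SO_orbit A B C x"
    using SO_mult[OF _ assms] by (auto simp: SO_orbit_def matrix_vector_mul_assoc)
  obtain \<delta> where \<delta>: "\<delta> \<in> SO_bqf A B C" "\<And>x. \<delta> *v (\<gamma> *v x) = x" using SO_inverse[OF assms] by metis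
  show "SO_orbit A B C x \<subseteq> SO_orbit A B C (\<gamma> *v x)"
  proof
    fix y assume "y \<in> SO_orbit A B C x"
    then obtain \<beta> where \<beta>: "\<beta> \<in> SO_bqf A B C" "y = \<beta> *v x" by (auto simp: SO_orbit_def)
    then have "y = (\<beta> ** \<delta>) *v (\<gamma> *v x)" by (simp add: \<delta>(2) flip: matrix_vector_mul_assoc)
    with SO_mult[OF \<beta>(1) \<delta>(1)] show "y \<in> SO_orbit A B C (\<gamma> *v x)"
      by (auto simp: SO_orbit_def)
  qed
qed

lemma SO_primitive_vectors:
  assumes "\<gamma> \<in> SO_bqf A B C" "x \<in> primitive_vectors"
  shows "\<gamma> *v x \<in> primitive_vectors"
proof -
  obtain \<delta> where \<delta>: "\<And>x. \<delta> *v (\<gamma> *v x) = x" using SO_inverse[OF assms(1)] by metis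
  have "coprime ((\<gamma> *v x) $ 1) ((\<gamma> *v x) $ 2)"
  proof (rule coprimeI)
    fix g assume "g dvd (\<gamma> *v x) $ 1" "g dvd (\<gamma> *v x) $ 2"
    then have "g dvd (\<delta> *v (\<gamma> *v x)) $ 1" "g dvd (\<delta> *v (\<gamma> *v x)) $ 2"
      unfolding matrix_vector_2[of \<delta>] by simp_all
    then show "is_unit g"
      using assms(2) unfolding \<delta> by (auto simp: primitive_vectors_def dest: coprime_common_divisor)
  qed
  then show ?thesis by (simp add: primitive_vectors_def)
qed

section \<open>Orbits of an indefinite irreducible form\<close>

locale indefinite_bqf =
  fixes A B C :: int
  assumes primitive: "bqf_primitive A B C"
    and indefinite: "bqf_indefinite A B C"
    and irreducible: "\<not> bqf_product_of_linear_forms A B C"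
begin

abbreviation D :: int where "D \<equiv> bqf_disc A B C"
abbreviation Q :: "int ^ 2 \<Rightarrow> int" where "Q \<equiv> bqf A B C"
abbreviation G :: "(int ^ 2 ^ 2) set" where "G \<equiv> SO_bqf A B C"
definition w :: real where "w = sqrt (real_of_int D)"
definition eps :: real where "eps = fundamental_unit D"

text \<open>The coefficient vectors of the two conjugate linear factors \<open>\<xi>\<close> and \<open>\<eta>\<close> of \<open>4 A Q\<close>. Both are
eigenfunctions of every automorph, with mutually inverse eigenvalues.\<close>

definition pvec :: "real \<times> real" where "pvec = (2 * real_of_int A, real_of_int B + w)"
definition qvec :: "real \<times> real" where "qvec = (2 * real_of_int A, real_of_int B - w)"
definition xi :: "int ^ 2 \<Rightarrow> real" where "xi x = pvec \<bullet> (real_of_int (x $ 1), real_of_int (x $ 2))"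
definition eta :: "int ^ 2 \<Rightarrow> real" where "eta x = qvec \<bullet> (real_of_int (x $ 1), real_of_int (x $ 2))"

text \<open>If \<open>A = 0\<close>, then \<open>Y\<close> divides the form.\<close>

lemma A_nonzero: "A \<noteq> 0"
proof
  assume "A = 0"
  then have "\<forall>x :: rat ^ 2. bqf A B C x =
      1 * ((of_int 0 * x $ 1 + of_int 1 * x $ 2) * (of_int B * x $ 1 + of_int C * x $ 2))"
    by (simp add: bqf_def power2_eq_square algebra_simps)
  then show False
    using irreducible unfolding bqf_product_of_linear_forms_def by (metis zero_neq_one)
qed

text \<open>If \<open>D = k\<^sup>2\<close>, then \<open>4 A Q = (2 A X + (B + k) Y) (2 A X + (B - k) Y)\<close>.\<close>

lemma D_nonsquare: "D \<noteq> k\<^sup>2"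
proof
  assume k: "D = k\<^sup>2"
  have "(of_int B)\<^sup>2 - 4 * of_int A * of_int C = (of_int k :: rat)\<^sup>2"
    using arg_cong[OF k[unfolded bqf_disc_def], of "of_int :: int \<Rightarrow> rat"] by simp
  then have C: "(of_int k :: rat)\<^sup>2 = (of_int B)\<^sup>2 - 4 * of_int A * of_int C" ..
  have "\<forall>x :: rat ^ 2. bqf A B C x = 1 / (4 * of_int A) *
     ((of_int (2 * A) * x $ 1 + of_int (B + k) * x $ 2) * (of_int (2 * A) * x $ 1 + of_int (B - k) * x $ 2))"
  proof
    fix x :: "rat ^ 2"
    have "(of_int (2 * A) * x $ 1 + of_int (B + k) * x $ 2) * (of_int (2 * A) * x $ 1 + of_int (B - k) * x $ 2)
      = 4 * (of_int A)\<^sup>2 * (x $ 1)\<^sup>2 + 4 * of_int A * of_int B * x $ 1 * x $ 2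
        + ((of_int B)\<^sup>2 - (of_int k)\<^sup>2) * (x $ 2)\<^sup>2"
      by (simp add: power2_eq_square algebra_simps)
    also have "\<dots> = 4 * of_int A * bqf A B C x"
      unfolding C by (simp add: bqf_def power2_eq_square algebra_simps)
    finally show "bqf A B C x = 1 / (4 * of_int A) *
     ((of_int (2 * A) * x $ 1 + of_int (B + k) * x $ 2) * (of_int (2 * A) * x $ 1 + of_int (B - k) * x $ 2))"
      using A_nonzero by simp
  qed
  moreover have "1 / (4 * of_int A :: rat) \<noteq> 0" using A_nonzero by simp
  ultimately show False
    using irreducible unfolding bqf_product_of_linear_forms_def by blast
qed

text \<open>Completing the square, \<open>4 A Q = (2 A X + B Y)\<^sup>2 - D Y\<^sup>2\<close>, so for \<open>D \<le> 0\<close> the form has constant sign.\<close>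

lemma D_pos: "D > 0"
proof (rule ccontr)
  assume "\<not> D > 0"
  then have D: "real_of_int D \<le> 0" by simp
  have nonneg: "real_of_int A * bqf A B C x \<ge> 0" for x :: "real ^ 2"
  proof -
    have "4 * (real_of_int A * bqf A B C x)
        = (2 * of_int A * x $ 1 + of_int B * x $ 2)\<^sup>2 - of_int D * (x $ 2)\<^sup>2"
      by (simp add: bqf_def bqf_disc_def power2_eq_square algebra_simps)
    also have "\<dots> \<ge> 0"
      using mult_nonpos_nonneg[OF D zero_le_power2[of "x $ 2"]]
        zero_le_power2[of "2 * of_int A * x $ 1 + of_int B * x $ 2"] by linarith
    finally show ?thesis by simp
  qed
  obtain x y :: "real ^ 2" where "bqf A B C x > 0" "bqf A B C y < 0"
    using indefinite by (auto simp: bqf_indefinite_def)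
  with nonneg[of x] nonneg[of y] A_nonzero show False
    by (auto simp: zero_le_mult_iff)
qed

lemma w_pos: "w > 0" using D_pos by (simp add: w_def)
lemma w_sq: "w\<^sup>2 = real_of_int D" using D_pos by (simp add: w_def)

lemma one_w_independent:
  assumes "real_of_int m + real_of_int n * w = 0"
  shows "m = 0 \<and> n = 0"
proof -
  have "n = 0"
  proof (rule ccontr)
    assume "n \<noteq> 0"
    then have "w = - real_of_int m / real_of_int n"
      using assms by (simp add: field_simps)
    also have "\<dots> \<in> \<rat>" by simp
    finally show False
      using sqrt_irrational_of_nonsquare[OF D_pos D_nonsquare] by (simp add: w_def)
  qed
  with assms show ?thesis by simp
qed

lemma xi_expand: "xi x = real_of_int (2 * A * x $ 1 + B * x $ 2) + real_of_int (x $ 2) * w"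
  by (simp add: xi_def pvec_def inner_prod_def algebra_simps)

lemma xi_inj:
  assumes "xi x = xi y"
  shows "x = y"
proof -
  have "real_of_int (2 * A * (x $ 1 - y $ 1) + B * (x $ 2 - y $ 2)) + real_of_int (x $ 2 - y $ 2) * w = 0"
    using assms by (simp add: xi_expand algebra_simps)
  from one_w_independent[OF this] have "x $ 2 = y $ 2" "A * (x $ 1 - y $ 1) = 0" by auto
  then show ?thesis
    using A_nonzero by (simp add: vec_eq_iff forall_2)
qed

lemma xi_eta: "xi x * eta x = 4 * real_of_int A * real_of_int (Q x)"
proof -
  have "xi x * eta x = (2 * A * x $ 1 + B * x $ 2)\<^sup>2 - w\<^sup>2 * (real_of_int (x $ 2))\<^sup>2"
    by (simp add: xi_def eta_def pvec_def qvec_def inner_prod_def algebra_simps power2_eq_square)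
  also have "\<dots> = 4 * real_of_int A * real_of_int (Q x)"
    unfolding w_sq by (simp add: bqf_def bqf_disc_def power2_eq_square algebra_simps)
  finally show ?thesis .
qed

text \<open>Automorphs come from solutions of the Pell equation. Invariance of the form means
\<open>S \<gamma> = (\<gamma>\<^sup>T)\<^sup>-\<^sup>1 S\<close> for its symmetric matrix \<open>S\<close>, which is linear in the entries of \<open>\<gamma>\<close> as
\<open>det \<gamma> = 1\<close>. The resulting relations say that \<open>A\<close> divides \<open>A c\<close>, \<open>B c\<close> and \<open>C c\<close> for the lower left entry
\<open>c\<close>, and primitivity makes \<open>c / A = u\<close> integral.\<close>

lemma SO_entries:
  assumes "\<gamma> \<in> G"
  obtains t u where "t\<^sup>2 - D * u\<^sup>2 = 4" "2 * \<gamma> $ 1 $ 1 = t - B * u" "\<gamma> $ 1 $ 2 = - C * u"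
    "\<gamma> $ 2 $ 1 = A * u" "2 * \<gamma> $ 2 $ 2 = t + B * u"
proof -
  define a b c d where abcd: "a = \<gamma> $ 1 $ 1" "b = \<gamma> $ 1 $ 2" "c = \<gamma> $ 2 $ 1" "d = \<gamma> $ 2 $ 2"
  have det: "a * d - b * c = 1"
    using assms by (simp add: SO_bqf_def SL2Z_def det_2 abcd)
  have inv: "Q (\<gamma> *v x) = Q x" for x using assms by (simp add: SO_bqf_def)
  have e1: "A * a\<^sup>2 + B * a * c + C * c\<^sup>2 = A"
    using inv[of "vector [1, 0]"] by (simp add: bqf_def matrix_vector_2 abcd)
  have e2: "A * b\<^sup>2 + B * b * d + C * d\<^sup>2 = C"
    using inv[of "vector [0, 1]"] by (simp add: bqf_def matrix_vector_2 abcd)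
  have "A * (a + b)\<^sup>2 + B * (a + b) * (c + d) + C * (c + d)\<^sup>2 = A + B + C"
    using inv[of "vector [1, 1]"] by (simp add: bqf_def matrix_vector_2 abcd)
  then have e3: "2 * A * a * b + B * (a * d + b * c) + 2 * C * c * d = B"
    using e1 e2 by (simp add: algebra_simps power2_eq_square)
  have "(2 * A * a + B * c) * (a * d - b * c) = 2 * d * (A * a\<^sup>2 + B * a * c + C * c\<^sup>2)
      - c * (2 * A * a * b + B * (a * d + b * c) + 2 * C * c * d)"
    by (simp add: power2_eq_square algebra_simps)
  then have "2 * A * a + B * c = 2 * d * A - c * B"
    unfolding det e1 e3 by simp
  then have r1: "A * (d - a) = B * c" by (simp add: algebra_simps)
  have "(2 * A * b + B * d) * (a * d - b * c) = d * (2 * A * a * b + B * (a * d + b * c) + 2 * C * c * d)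
      - 2 * c * (A * b\<^sup>2 + B * b * d + C * d\<^sup>2)"
    by (simp add: power2_eq_square algebra_simps)
  then have "2 * A * b + B * d = d * B - 2 * c * C"
    unfolding det e2 e3 by simp
  then have r2: "A * b = - C * c" by (simp add: algebra_simps)
  obtain x y z where xyz: "A * x + B * y + C * z = 1"
  proof -
    let ?g = "gcd A B"
    have "gcd ?g C = 1"
    proof -
      have "gcd ?g C = 1 \<or> gcd ?g C = -1"
        using primitive unfolding bqf_primitive_def
        by (meson dvd_trans gcd_dvd1 gcd_dvd2)
      then show ?thesis using gcd_ge_0_int[of ?g C] by linarith
    qed
    then obtain p q where pq: "p * ?g + q * C = 1" using bezout_int[of ?g C] by metis
    obtain p' q' where g: "p' * A + q' * B = ?g" using bezout_int[of A B] by metis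
    have "A * (p * p') + B * (p * q') + C * q = p * (p' * A + q' * B) + q * C"
      by (simp add: algebra_simps)
    also have "\<dots> = 1" unfolding g by (rule pq)
    finally have "A * (p * p') + B * (p * q') + C * q = 1" .
    then show thesis by (rule that)
  qed
  have "c = A * (c * x + (d - a) * y - b * z)"
    using xyz r1 r2 by algebra
  then obtain u where u: "c = A * u" by blast
  have b: "b = - C * u"
  proof -
    have "A * b = A * (- C * u)" using r2 u by (simp add: algebra_simps)
    then show ?thesis by (rule mult_left_cancel[THEN iffD1, OF A_nonzero])
  qed
  have da: "d - a = B * u"
  proof -
    have "A * (d - a) = A * (B * u)" using r1 u by (simp add: algebra_simps)
    then show ?thesis by (rule mult_left_cancel[THEN iffD1, OF A_nonzero])
  qed
  show thesis
  proof (rule that[of "a + d" u])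
    show "(a + d)\<^sup>2 - D * u\<^sup>2 = 4"
      using da b u det unfolding bqf_disc_def by algebra
  qed (use da b u in \<open>simp_all flip: abcd\<close>)
qed

lemma xi_action:
  assumes "2 * \<gamma> $ 1 $ 1 = t - B * u" "\<gamma> $ 1 $ 2 = - C * u" "\<gamma> $ 2 $ 1 = A * u" "2 * \<gamma> $ 2 $ 2 = t + B * u"
  shows "xi (\<gamma> *v x) = (real_of_int t + real_of_int u * w) / 2 * xi x"
proof -
  have e: "2 * real_of_int (\<gamma> $ 1 $ 1) = t - B * u" "2 * real_of_int (\<gamma> $ 2 $ 2) = t + B * u"
    using assms(1,4) by linarith+
  have w: "w * w = real_of_int B * B - 4 * A * C"
    using w_sq by (simp add: bqf_disc_def power2_eq_square)
  have "2 * xi (\<gamma> *v x) = 2 * A * ((2 * real_of_int (\<gamma> $ 1 $ 1)) * x $ 1 + 2 * real_of_int (\<gamma> $ 1 $ 2) * x $ 2)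
      + (B + w) * (2 * real_of_int (\<gamma> $ 2 $ 1) * x $ 1 + (2 * real_of_int (\<gamma> $ 2 $ 2)) * x $ 2)"
    by (simp add: xi_def pvec_def inner_prod_def matrix_vector_2 algebra_simps)
  also have "\<dots> = (real_of_int t + real_of_int u * w) * xi x"
    unfolding e assms(2,3) using w by (simp add: xi_def pvec_def inner_prod_def) algebra
  finally show ?thesis by simp
qed

text \<open>The parity condition needed for integral entries is automatic, because \<open>t\<^sup>2 - (B u)\<^sup>2\<close> is divisible by \<open>4\<close>.\<close>

lemma SO_of_Pell:
  assumes "t\<^sup>2 - D * u\<^sup>2 = 4"
  shows "\<exists>\<gamma>\<in>G. \<forall>x. xi (\<gamma> *v x) = (real_of_int t + real_of_int u * w) / 2 * xi x"
proof -
  have "t\<^sup>2 - (B * u)\<^sup>2 = 4 * (1 - A * C * u\<^sup>2)"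
    using assms by (simp add: bqf_disc_def power2_eq_square algebra_simps)
  then have "even (t\<^sup>2 - (B * u)\<^sup>2)" by simp
  then have "even (t - B * u)" "even (t + B * u)" by auto
  then obtain a d where a: "t - B * u = 2 * a" and d: "t + B * u = 2 * d" by (elim evenE)
  define \<gamma> :: "int ^ 2 ^ 2" where "\<gamma> = vector [vector [a, - C * u], vector [A * u, d]]"
  have ent: "\<gamma> $ 1 $ 1 = a" "\<gamma> $ 1 $ 2 = - C * u" "\<gamma> $ 2 $ 1 = A * u" "\<gamma> $ 2 $ 2 = d"
    by (simp_all add: \<gamma>_def)
  have da: "d = a + B * u" using a d by linarith
  have "4 * (a * d + A * C * u\<^sup>2) = (2 * a) * (2 * d) + 4 * A * C * u\<^sup>2"
    by simp
  also have "\<dots> = 4"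
    unfolding a[symmetric] d[symmetric] using assms by (simp add: bqf_disc_def power2_eq_square algebra_simps)
  finally have det: "a * d + A * C * u\<^sup>2 = 1" by simp
  have "\<gamma> \<in> SL2Z"
    using det by (simp add: SL2Z_def det_2 ent power2_eq_square algebra_simps)
  moreover have "Q (\<gamma> *v x) = Q x" for x
  proof -
    have "Q (\<gamma> *v x) = Q x * (a * d + A * C * u\<^sup>2)"
      unfolding bqf_def matrix_vector_2 ent da by (simp add: power2_eq_square algebra_simps)
    then show ?thesis by (simp add: det)
  qed
  ultimately have "\<gamma> \<in> G" by (simp add: SO_bqf_def)
  moreover have "xi (\<gamma> *v x) = (real_of_int t + real_of_int u * w) / 2 * xi x" for x
    by (rule xi_action) (simp_all add: ent a d)
  ultimately show ?thesis by blast
qed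

definition tQ :: int where "tQ = fst (fundamental_solution D)"
definition uQ :: int where "uQ = snd (fundamental_solution D)"

lemma fundamental:
  "tQ > 0" "uQ > 0" "tQ\<^sup>2 - D * uQ\<^sup>2 = 4"
  "t > 0 \<Longrightarrow> u > 0 \<Longrightarrow> t\<^sup>2 - D * u\<^sup>2 = 4 \<Longrightarrow> uQ \<le> u"
  using fundamental_solution[OF D_pos D_nonsquare]
  by (auto simp: is_fundamental_solution_def tQ_def uQ_def case_prod_unfold)

lemma eps_eq: "eps = (real_of_int tQ + real_of_int uQ * w) / 2"
  by (simp add: eps_def fundamental_unit_def tQ_def uQ_def w_def case_prod_unfold)

lemma Pell_norm_factorisation:
  assumes "t\<^sup>2 - D * u\<^sup>2 = 4"
  shows "(real_of_int t + real_of_int u * w) / 2 * ((real_of_int t - real_of_int u * w) / 2) = 1"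
proof -
  have "(real_of_int t + real_of_int u * w) * (real_of_int t - real_of_int u * w)
      = real_of_int (t\<^sup>2) - w\<^sup>2 * real_of_int (u\<^sup>2)"
    by (simp add: power2_eq_square algebra_simps)
  also have "\<dots> = real_of_int (t\<^sup>2 - D * u\<^sup>2)" unfolding w_sq by simp
  finally show ?thesis unfolding assms by simp
qed

text \<open>The conjugate of a unit \<open>e > 1\<close> of norm \<open>1\<close> is \<open>1/e\<close>, which lies between \<open>0\<close> and \<open>1\<close>; \<open>t\<close> and \<open>u \<surd>D\<close>
are the sum and the difference of the two.\<close>

lemma Pell_unit_gt_1_imp_pos:
  assumes "t\<^sup>2 - D * u\<^sup>2 = 4" "(real_of_int t + real_of_int u * w) / 2 > 1"
  shows "t > 0" "u > 0"
proof -
  define e where "e = (real_of_int t + real_of_int u * w) / 2"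
  define e' where "e' = (real_of_int t - real_of_int u * w) / 2"
  have ee: "e * e' = 1" unfolding e_def e'_def by (rule Pell_norm_factorisation[OF assms(1)])
  have e: "e > 1" using assms(2) by (simp add: e_def)
  have e': "e' > 0" using ee e by (metis less_trans zero_less_mult_pos zero_less_one)
  have "e' < 1"
  proof (rule ccontr)
    assume "\<not> e' < 1"
    then have "e * 1 \<le> e * e'" using e by (intro mult_left_mono) auto
    then show False using ee e by simp
  qed
  have "real_of_int t = e + e'" "real_of_int u * w = e - e'"
    by (simp_all add: e_def e'_def field_simps)
  then have "real_of_int t > 0" "real_of_int u * w > 0" using e e' \<open>e' < 1\<close> by linarith+
  then show "t > 0" "u > 0" using w_pos by (simp_all add: zero_less_mult_iff)
qed

lemma eps_gt_1: "eps > 1"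
proof -
  have "D * uQ\<^sup>2 \<ge> 0" using D_pos by simp
  then have "tQ\<^sup>2 \<ge> 2\<^sup>2" using fundamental(3) by simp
  then have "tQ \<ge> 2" using power2_le_imp_le[of 2 tQ] fundamental(1) by simp
  moreover have "real_of_int uQ * w > 0" using fundamental(2) w_pos by simp
  ultimately show ?thesis by (simp add: eps_eq)
qed

text \<open>The fundamental solution has the least \<open>u\<close>, hence also the least \<open>t\<close>, hence gives the least unit
greater than \<open>1\<close>.\<close>

lemma eps_minimal:
  assumes "t\<^sup>2 - D * u\<^sup>2 = 4" "(real_of_int t + real_of_int u * w) / 2 > 1"
  shows "eps \<le> (real_of_int t + real_of_int u * w) / 2"
proof -
  note pos = Pell_unit_gt_1_imp_pos[OF assms]
  have u: "uQ \<le> u" by (rule fundamental(4)[OF pos assms(1)])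
  have "D * uQ\<^sup>2 \<le> D * u\<^sup>2"
    using u fundamental(2) D_pos by (intro mult_left_mono power_mono) auto
  then have "tQ\<^sup>2 \<le> t\<^sup>2" using fundamental(3) assms(1) by linarith
  then have "tQ \<le> t" using pos(1) by (simp add: power2_le_iff_abs_le)
  moreover have "real_of_int uQ * w \<le> real_of_int u * w"
    using u w_pos by (intro mult_right_mono) auto
  ultimately show ?thesis by (simp add: eps_eq)
qed

lemma SO_multiplier:
  assumes "\<gamma> \<in> G"
  obtains e where "\<And>x. xi (\<gamma> *v x) = e * xi x" "e > 1 \<Longrightarrow> eps \<le> e"
proof -
  obtain t u where tu: "t\<^sup>2 - D * u\<^sup>2 = 4" "2 * \<gamma> $ 1 $ 1 = t - B * u" "\<gamma> $ 1 $ 2 = - C * u"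
    "\<gamma> $ 2 $ 1 = A * u" "2 * \<gamma> $ 2 $ 2 = t + B * u"
    by (rule SO_entries[OF assms])
  show thesis
    by (rule that[of "(real_of_int t + real_of_int u * w) / 2"])
      (use xi_action[OF tu(2-5)] eps_minimal[OF tu(1)] in auto)
qed

lemma SO_multiplier_power:
  assumes "\<exists>\<gamma>\<in>G. \<forall>x. xi (\<gamma> *v x) = e * xi x"
  shows "\<exists>\<gamma>\<in>G. \<forall>x. xi (\<gamma> *v x) = e ^ n * xi x"
proof (induction n)
  case 0
  have "(mat 1 :: int ^ 2 ^ 2) \<in> G" by (simp add: SO_bqf_def SL2Z_def)
  then show ?case by (intro bexI[of _ "mat 1"]) auto
next
  case (Suc n)
  then obtain \<gamma> \<delta> where "\<gamma> \<in> G" "\<delta> \<in> G" "\<And>x. xi (\<gamma> *v x) = e ^ n * xi x" "\<And>x. xi (\<delta> *v x) = e * xi x"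
    using assms by blast
  then show ?case
    by (intro bexI[of _ "\<gamma> ** \<delta>"] SO_mult) (auto simp flip: matrix_vector_mul_assoc)
qed

text \<open>Every integral power of \<open>eps\<close> is an eigenvalue; the negative ones come from the solution
\<open>(tQ, -uQ)\<close>, whose unit is \<open>1 / eps\<close>.\<close>

lemma SO_eps_powr: "\<exists>\<gamma>\<in>G. \<forall>x. xi (\<gamma> *v x) = eps powr real_of_int n * xi x"
proof (cases n rule: int_cases2)
  case (nonneg m)
  have "\<exists>\<gamma>\<in>G. \<forall>x. xi (\<gamma> *v x) = eps * xi x"
    using SO_of_Pell[OF fundamental(3)] by (simp only: eps_eq)
  from SO_multiplier_power[OF this, of m] show ?thesis
    using eps_gt_1 nonneg by (simp add: powr_realpow)
next
  case (nonpos m)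
  have "(real_of_int tQ + real_of_int (- uQ) * w) / 2 = 1 / eps"
    using Pell_norm_factorisation[OF fundamental(3)] eps_gt_1 by (simp add: eps_eq field_simps)
  moreover have "\<exists>\<gamma>\<in>G. \<forall>x. xi (\<gamma> *v x) = (real_of_int tQ + real_of_int (- uQ) * w) / 2 * xi x"
    by (rule SO_of_Pell) (use fundamental(3) in simp)
  ultimately have "\<exists>\<gamma>\<in>G. \<forall>x. xi (\<gamma> *v x) = 1 / eps * xi x" by simp
  from SO_multiplier_power[OF this, of m] show ?thesis
    using eps_gt_1 nonpos by (simp add: powr_minus powr_realpow power_divide inverse_eq_divide)
qed

text \<open>The automorph \<open>-1\<close> makes \<open>\<xi>\<close> positive. The intervals \<open>[eps\<^sup>n s, eps\<^sup>n\<^sup>+\<^sup>1 s)\<close> partition the positive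
reals, so a power of \<open>eps\<close> then moves \<open>\<xi>\<close> into the window.\<close>

lemma SO_move_into_window:
  assumes "xi x \<noteq> 0" "s > 0"
  shows "\<exists>\<gamma>\<in>G. s \<le> xi (\<gamma> *v x) \<and> xi (\<gamma> *v x) < eps * s"
proof -
  have "\<exists>\<delta>\<in>G. \<forall>x. xi (\<delta> *v x) = - 1 * xi x"
    using SO_of_Pell[of "-2" 0] by simp
  then obtain \<delta> where \<delta>: "\<delta> \<in> G" "\<And>x. xi (\<delta> *v x) = - xi x" by auto
  have "\<exists>\<beta>\<in>G. xi (\<beta> *v x) = \<bar>xi x\<bar>"
  proof (cases "xi x > 0")
    case True
    have "(mat 1 :: int ^ 2 ^ 2) \<in> G" by (simp add: SO_bqf_def SL2Z_def)
    then show ?thesis using True by (intro bexI[of _ "mat 1"]) auto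
  next
    case False
    then show ?thesis using \<delta> by (intro bexI[of _ \<delta>]) auto
  qed
  then obtain \<beta> where \<beta>: "\<beta> \<in> G" "xi (\<beta> *v x) = \<bar>xi x\<bar>" by blast
  define r where "r = \<bar>xi x\<bar>"
  have r: "r > 0" using assms(1) by (simp add: r_def)
  define n where "n = \<lceil>log eps (s / r)\<rceil>"
  obtain \<gamma> where \<gamma>: "\<gamma> \<in> G" "\<And>x. xi (\<gamma> *v x) = eps powr real_of_int n * xi x"
    using SO_eps_powr[of n] by blast
  have "s / r = eps powr log eps (s / r)"
    using eps_gt_1 assms(2) r by simp
  also have "\<dots> \<le> eps powr real_of_int n"
    using eps_gt_1 by (intro powr_mono) (auto simp: n_def)
  finally have lower: "s \<le> eps powr real_of_int n * r"
    using r by (simp add: field_simps)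
  have "eps powr real_of_int n < eps powr (log eps (s / r) + 1)"
    using eps_gt_1 by (intro powr_less_mono) (auto simp: n_def, linarith)
  also have "\<dots> = s / r * eps"
    using eps_gt_1 assms(2) r by (simp add: powr_add)
  finally have upper: "eps powr real_of_int n * r < eps * s"
    using r by (simp add: field_simps)
  have "xi ((\<gamma> ** \<beta>) *v x) = eps powr real_of_int n * r"
    by (simp add: \<gamma>(2) \<beta>(2) r_def flip: matrix_vector_mul_assoc)
  then show ?thesis
    using SO_mult[OF \<gamma>(1) \<beta>(1)] lower upper by (intro bexI[of _ "\<gamma> ** \<beta>"]) auto
qed

text \<open>Two points of the window have \<open>\<xi>\<close>-ratio strictly less than \<open>eps\<close>, and there is no eigenvalue strictly
between \<open>1\<close> and \<open>eps\<close>; so \<open>\<xi>\<close> agrees at both points, and \<open>\<xi>\<close> is injective on integral vectors. Ordering the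
two points by \<open>\<xi>\<close> spares the eigenvalues below \<open>1\<close>.\<close>

lemma SO_window_unique:
  assumes "\<gamma> \<in> G" "s > 0" "s \<le> xi x" "xi (\<gamma> *v x) < eps * s" "xi x \<le> xi (\<gamma> *v x)"
  shows "\<gamma> *v x = x"
proof -
  obtain e where e: "\<And>x. xi (\<gamma> *v x) = e * xi x" "e > 1 \<Longrightarrow> eps \<le> e"
    using SO_multiplier[OF assms(1)] by metis
  have "\<not> e > 1"
  proof
    assume "e > 1"
    then have "eps * s \<le> e * xi x"
      using e(2) assms eps_gt_1 by (intro mult_mono) auto
    then show False using assms(4) e(1) by simp
  qed
  moreover have "\<not> e < 1"
  proof
    assume "e < 1"
    then have "e * xi x < 1 * xi x" using assms by (intro mult_strict_right_mono) auto
    then show False using assms(5) e(1) by simp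
  qed
  ultimately have "e = 1" by linarith
  then show ?thesis using e(1) by (intro xi_inj) simp
qed

text \<open>The window \<open>s \<le> \<xi> < eps s\<close> contains one point of each orbit for every \<open>s > 0\<close>. The choice \<open>s = \<surd>t\<close>, which
makes the window depend on \<open>t\<close>, turns the set of representatives into a dilate of one fixed region.\<close>

lemma Psi_eq_prim_points:
  assumes "t > 0"
  shows "Psi_bqf A B C t = card (prim_points (hyp_sector pvec qvec eps (4 * \<bar>real_of_int A\<bar>)) (sqrt t))"
proof -
  define s where "s = sqrt t"
  have s: "s > 0" "s\<^sup>2 = t" using assms by (simp_all add: s_def)
  define P where "P = {x \<in> primitive_vectors. real_of_int \<bar>Q x\<bar> \<le> t}"
  define F where "F = {x \<in> P. s \<le> xi x \<and> xi x < eps * s}"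
  let ?O = "SO_orbit A B C"
  have self: "x \<in> ?O x" for x
  proof -
    have "(mat 1 :: int ^ 2 ^ 2) \<in> G" by (simp add: SO_bqf_def SL2Z_def)
    then show ?thesis unfolding SO_orbit_def by (intro image_eqI[of _ _ "mat 1"]) auto
  qed
  have "inj_on ?O F"
  proof (rule inj_onI)
    have *: "x = y" if "x \<in> F" "y \<in> F" "?O x = ?O y" "xi x \<le> xi y" for x y
    proof -
      have "y \<in> ?O x" using self[of y] that(3) by simp
      then obtain \<gamma> where "\<gamma> \<in> G" "y = \<gamma> *v x" by (auto simp: SO_orbit_def)
      then show ?thesis
        using SO_window_unique[of \<gamma> s x] that s by (auto simp: F_def)
    qed
    fix x y assume "x \<in> F" "y \<in> F" "?O x = ?O y"
    then show "x = y" using *[of x y] *[of y x] by (cases "xi x \<le> xi y") auto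
  qed
  moreover have "?O ` P = ?O ` F"
  proof
    show "?O ` F \<subseteq> ?O ` P" by (auto simp: F_def)
    show "?O ` P \<subseteq> ?O ` F"
    proof clarify
      fix x assume x: "x \<in> P"
      have "x \<noteq> 0" using x by (auto simp: P_def primitive_vectors_def)
      then have "xi x \<noteq> 0" using xi_inj[of x 0] by (auto simp: xi_expand)
      then obtain \<gamma> where \<gamma>: "\<gamma> \<in> G" "s \<le> xi (\<gamma> *v x)" "xi (\<gamma> *v x) < eps * s"
        using SO_move_into_window s by blast
      have "Q (\<gamma> *v x) = Q x" using \<gamma>(1) by (simp add: SO_bqf_def)
      then have "\<gamma> *v x \<in> F"
        using SO_primitive_vectors[OF \<gamma>(1)] x \<gamma> by (auto simp: F_def P_def)
      then show "?O x \<in> ?O ` F" using SO_orbit_invariant[OF \<gamma>(1), of x] by (metis imageI)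
    qed
  qed
  ultimately have "Psi_bqf A B C t = card F"
    by (simp add: Psi_bqf_def P_def card_image)
  also have "card F = card (prim_points (hyp_sector pvec qvec eps (4 * \<bar>real_of_int A\<bar>)) s)"
  proof (rule bij_betw_same_card[of "\<lambda>x. (x $ 1, x $ 2)"])
    let ?H = "hyp_sector pvec qvec eps (4 * \<bar>real_of_int A\<bar>)"
    have mem: "x \<in> F \<longleftrightarrow> (x $ 1, x $ 2) \<in> prim_points ?H s" for x
    proof -
      let ?z = "(real_of_int (x $ 1) / s, real_of_int (x $ 2) / s)"
      have p: "pvec \<bullet> ?z = xi x / s" "qvec \<bullet> ?z = eta x / s"
        by (simp_all add: xi_def eta_def pvec_def qvec_def inner_prod_def add_divide_distrib)
      have "\<bar>(xi x / s) * (eta x / s)\<bar> = \<bar>xi x * eta x\<bar> / s\<^sup>2"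
        by (simp add: abs_mult power2_eq_square)
      then have "\<bar>(xi x / s) * (eta x / s)\<bar> \<le> 4 * \<bar>real_of_int A\<bar>
          \<longleftrightarrow> \<bar>xi x * eta x\<bar> \<le> 4 * \<bar>real_of_int A\<bar> * s\<^sup>2"
        using s(1) by (simp only: pos_divide_le_eq zero_less_power)
      also have "\<dots> \<longleftrightarrow> 4 * \<bar>real_of_int A\<bar> * \<bar>real_of_int (Q x)\<bar> \<le> 4 * \<bar>real_of_int A\<bar> * t"
        unfolding xi_eta s(2) by (simp add: abs_mult)
      also have "\<dots> \<longleftrightarrow> real_of_int \<bar>Q x\<bar> \<le> t"
        using A_nonzero by simp
      finally have "\<bar>(xi x / s) * (eta x / s)\<bar> \<le> 4 * \<bar>real_of_int A\<bar> \<longleftrightarrow> real_of_int \<bar>Q x\<bar> \<le> t" .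
      then have "?z \<in> ?H \<longleftrightarrow> s \<le> xi x \<and> xi x < eps * s \<and> real_of_int \<bar>Q x\<bar> \<le> t"
        unfolding hyp_sector_def mem_Collect_eq p using s by (simp add: field_simps)
      then show ?thesis
        by (auto simp: F_def P_def primitive_vectors_def prim_points_def)
    qed
    show "bij_betw (\<lambda>x. (x $ 1, x $ 2)) F (prim_points ?H s)"
    proof (rule bij_betwI[where g = "\<lambda>(m, n). vector [m, n]"])
      show "(\<lambda>x. (x $ 1, x $ 2)) \<in> F \<rightarrow> prim_points ?H s" using mem by auto
      show "(\<lambda>(m, n). vector [m, n]) \<in> prim_points ?H s \<rightarrow> F"
      proof
        fix p assume p: "p \<in> prim_points ?H s"
        obtain m n where mn: "p = (m, n)" by (cases p)
        show "(case p of (m, n) \<Rightarrow> vector [m, n]) \<in> F"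
          using p unfolding mn mem by simp
      qed
    qed (auto simp: vec_eq_iff forall_2)
  qed
  finally show ?thesis by (simp add: s_def)
qed

theorem Psi_density:
  "((\<lambda>t. real (Psi_bqf A B C t) / t) \<longlongrightarrow> 12 * ln eps / (pi\<^sup>2 * w)) at_top"
proof -
  define H where "H = hyp_sector pvec qvec eps (4 * \<bar>real_of_int A\<bar>)"
  define f where "f s = real (card (prim_points H s)) / s\<^sup>2" for s
  have k: "4 * \<bar>real_of_int A\<bar> > 0" using A_nonzero by simp
  have det: "fst pvec * snd qvec - snd pvec * fst qvec = - (4 * real_of_int A * w)"
    by (simp add: pvec_def qvec_def algebra_simps)
  have nz: "fst pvec \<noteq> 0" "fst pvec * snd qvec - snd pvec * fst qvec \<noteq> 0"
    unfolding det using A_nonzero w_pos by (auto simp: pvec_def)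
  have "emeasure lborel H = ennreal (2 * (4 * \<bar>real_of_int A\<bar>) * ln eps / \<bar>- (4 * real_of_int A * w)\<bar>)"
    unfolding H_def using emeasure_hyp_sector[OF nz eps_gt_1 k] by (simp only: det)
  also have "2 * (4 * \<bar>real_of_int A\<bar>) * ln eps / \<bar>- (4 * real_of_int A * w)\<bar> = 2 * ln eps / w"
    using A_nonzero w_pos by (simp add: abs_mult)
  finally have area: "measure lborel H = 2 * ln eps / w"
    using eps_gt_1 w_pos by (simp add: measure_def)
  have "(f \<longlongrightarrow> 6 * measure lborel H / pi\<^sup>2) at_top"
    unfolding f_def
  proof (rule primitive_lattice_count_area)
    show "bounded H" unfolding H_def by (rule bounded_hyp_sector[OF nz(2)])
    show "H \<in> sets borel" unfolding H_def by (rule hyp_sector_borel)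
    show "negligible (frontier H)"
      unfolding H_def by (rule negligible_frontier_hyp_sector[OF eps_gt_1 k])
    show "(0, 0) \<notin> H" by (simp add: H_def hyp_sector_def inner_prod_def)
  qed
  moreover have "6 * measure lborel H / pi\<^sup>2 = 12 * ln eps / (pi\<^sup>2 * w)"
    by (simp add: area)
  ultimately have "(f \<longlongrightarrow> 12 * ln eps / (pi\<^sup>2 * w)) at_top" by simp
  from filterlim_compose[OF this sqrt_at_top]
  have lim: "((\<lambda>t. f (sqrt t)) \<longlongrightarrow> 12 * ln eps / (pi\<^sup>2 * w)) at_top" .
  show ?thesis
  proof (rule Lim_transform_eventually[OF lim])
    show "\<forall>\<^sub>F t in at_top. f (sqrt t) = real (Psi_bqf A B C t) / t"
      using eventually_gt_at_top[of 0]
      by eventually_elim (simp add: f_def H_def Psi_eq_prim_points)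
  qed
qed

end

section \<open>The asymptotic count of orbits\<close>

theorem mainTheorem3:
  fixes A B C :: int
  assumes "bqf_primitive A B C"
    and "bqf_indefinite A B C"
    and "\<not> bqf_product_of_linear_forms A B C"
  shows "(\<lambda>t::real. real (Psi_bqf A B C t)) \<sim>[at_top]
           (\<lambda>t. 12 * bqf_regulator A B C / (pi\<^sup>2 * sqrt (of_int (bqf_disc A B C))) * t)"
proof -
  interpret indefinite_bqf A B C by (rule indefinite_bqf.intro[OF assms])
  define c where "c = 12 * bqf_regulator A B C / (pi\<^sup>2 * sqrt (of_int (bqf_disc A B C)))"
  have c: "c = 12 * ln eps / (pi\<^sup>2 * w)"
    by (simp add: c_def bqf_regulator_def eps_def w_def)
  have "c > 0" unfolding c using eps_gt_1 w_pos by simp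
  have "((\<lambda>t. real (Psi_bqf A B C t) / t / c) \<longlongrightarrow> c / c) at_top"
    using \<open>c > 0\<close> Psi_density unfolding c[symmetric] by (intro tendsto_divide tendsto_const) auto
  then have "((\<lambda>t. real (Psi_bqf A B C t) / (c * t)) \<longlongrightarrow> 1) at_top"
    using \<open>c > 0\<close> by (simp add: mult.commute)
  then show ?thesis
    unfolding c_def[symmetric] by (rule asymp_equivI')
qed

end
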